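(* Let $(h_\varepsilon(\cdot;t),h_\mu(\cdot;t))_{t\in[0,1]}$ be a continuous deformation of periodic media with $(h_\varepsilon(\cdot;0),h_\mu(\cdot;0))=(\boldsymbol{\varepsilon}_H,\boldsymbol{\mu}_H)$ a Hermitian photonic crystal and $(h_\varepsilon(\cdot;1),h_\mu(\cdot;1))=(\boldsymbol{\varepsilon},\boldsymbol{\mu})$. Let $\Gamma_t$ be the union of the dispersion curves of $(h_\varepsilon(\cdot;t),h_\mu(\cdot;t))$ and $\Gamma_t^c=\mathbb{C}\setminus\Gamma_t$. Let $D$ be a connected component of $\Gamma_1^c$. Assume that the spectrum of the Hermitian medium $(h_\varepsilon(\cdot;0),h_\mu(\cdot;0))$ contains a band gap (as a result, $\Gamma_0^c$ is a connected and unbounded domain), and that there is a continuous curve $g:[0,1]\to\mathbb{C}$ such that (i) $g(t)\in\Gamma_t^c$ for each $0\le t\le1$; (ii) $g(1)\in D$. Then $D$ is a principal gapped component, i.e. $\mathrm{Ind}(D;1)=0$.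
   Context: Medium. A photonic crystal is a pair $(\boldsymbol{\varepsilon},\boldsymbol{\mu})$ of bounded, piecewise continuous, $1$-periodic functions $\mathbb{R}\to\mathbb{C}^{2\times2}$. It is Hermitian if $\boldsymbol{\varepsilon}(z)=\boldsymbol{\varepsilon}(z)^*$ and $\boldsymbol{\mu}(z)=\boldsymbol{\mu}(z)^*$ are positive definite. A continuous deformation is a family $h_\varepsilon(\cdot;t),h_\mu(\cdot;t):\mathbb{R}\to\mathbb{C}^{2\times2}$, $t\in[0,1]$, such that for each $t$ the functions are $1$-periodic, bounded and piecewise continuous in $z$, and they depend continuously on $t$ in the $L^\infty$ norm. ODE and monodromy matrix. Put $Q=\begin{pmatrix}0&-1\\1&0\end{pmatrix}$, $\mathcal{Q}=\begin{pmatrix}Q&0\\0&Q\end{pmatrix}$. For a medium $(\boldsymbol{\varepsilon},\boldsymbol{\mu})$ put $\mathcal{A}(z)=\mathrm{i}\begin{pmatrix}0&\boldsymbol{\mu}(z)\\-\boldsymbol{\varepsilon}(z)&0\end{pmatrix}$. For $\omega\in\mathbb{C}$ let $\mathcal{T}_\omega(z,z_1)\in\mathbb{C}^{4\times4}$ solve $\frac{d}{dz}\mathcal{T}_\omega(z,z_1)=\omega\mathcal{Q}^{-1}\mathcal{A}(z)\mathcal{T}_\omega(z,z_1)$, $\mathcal{T}_\omega(z_1,z_1)=I$; the monodromy matrix is $\mathcal{M}(\omega)=\mathcal{T}_\omega(1,0)$. For the medium $(h_\varepsilon(\cdot;t),h_\mu(\cdot;t))$ it is denoted $\mathcal{M}(\omega;t)$,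 with eigenvalues $\lambda_1(\omega;t),\dots,\lambda_4(\omega;t)$ listed with algebraic multiplicity. Spectrum. For $k\in[-\pi,\pi]$, $\omega\in\mathbb{C}$ is an eigenfrequency at $k$ if $\Phi'(z)=\omega\mathcal{Q}^{-1}\mathcal{A}(z)\Phi(z)$, $\Phi(z+1)=e^{\mathrm{i}k}\Phi(z)$ has a nonzero solution. The union of dispersion curves is the set of all eigenfrequencies over all $k\in[-\pi,\pi]$; equivalently $\Gamma_t=\{\omega\in\mathbb{C}:|\lambda_j(\omega;t)|=1\text{ for some }j\}$. Band gap. For a Hermitian crystal and each $k$, the eigenfrequencies are real, and the non-negative ones are ordered (with multiplicity, as square roots of the eigenvalues $\omega^2$ of the equivalent second-order self-adjoint problem for the electric field) as $\omega_1(k)\le\omega_2(k)\le\cdots$, each $\omega_n$ continuous in $k$. The spectrum contains a band gap if $\max_k\omega_n(k)<\min_k\omega_{n+1}(k)$ for some $n\ge1$. Index. For a connected component $D_t$ of $\Gamma_t^c$, $\mathrm{Ind}(D_t;t)=\frac12\big(\#\{i:|\lambda_i(\omega;t)|<1\}-\#\{i:|\lambda_i(\omega;t)|>1\}\big)$ for $\omega\in D_t$; this value does not depend on $\omega\in D_t$. $D_t$ is a principal gapped component if $\mathrm{Ind}(D_t;t)=0$. *)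

theory Defs
  imports
    "HOL-Analysis.Analysis"
    "HOL-Computational_Algebra.Computational_Algebra"
    "HOL-Probability.Essential_Supremum"
    "HOL-Library.Function_Algebras"
begin

type_synonym cmat2 = "complex^2^2"
type_synonym cvec4 = "complex^(2 + 2)"
type_synonym cmat4 = "complex^(2 + 2)^(2 + 2)"
type_synonym medium = "real \<Rightarrow> cmat2"

section \<open>Media\<close>

definition locally_finite_set :: "real set \<Rightarrow> bool" where
  "locally_finite_set S \<longleftrightarrow> (\<forall>a b. finite (S \<inter> {a..b}))"

text \<open>One-sided limits at the exceptional points are not required; boundedness is a separate
  condition.\<close>

definition piecewise_continuous :: "(real \<Rightarrow> 'a::topological_space) \<Rightarrow> bool" where
  "piecewise_continuous f \<longleftrightarrow> (\<exists>S. locally_finite_set S \<and> (\<forall>z. z \<notin> S \<longrightarrow> isCont f z))"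

definition admissible :: "medium \<Rightarrow> bool" where
  "admissible f \<longleftrightarrow> bounded (range f) \<and> piecewise_continuous f \<and> (\<forall>z. f (z + 1) = f z)"

definition photonic_crystal :: "medium \<Rightarrow> medium \<Rightarrow> bool" where
  "photonic_crystal eps mu \<longleftrightarrow> admissible eps \<and> admissible mu"

definition conj_transpose :: "complex^'n^'m \<Rightarrow> complex^'m^'n" where
  "conj_transpose M = (\<chi> i j. cnj (M $ j $ i))"

text \<open>For a matrix equal to its conjugate transpose the quadratic form is real, so taking the
  real part loses nothing.\<close>

definition hermitian_posdef :: "complex^'n^'n \<Rightarrow> bool" where
  "hermitian_posdef M \<longleftrightarrow>
     conj_transpose M = M \<and> (\<forall>v. v \<noteq> 0 \<longrightarrow> 0 < Re (\<Sum>i\<in>UNIV. cnj (v $ i) * (M *v v) $ i))"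

definition hermitian_crystal :: "medium \<Rightarrow> medium \<Rightarrow> bool" where
  "hermitian_crystal eps mu \<longleftrightarrow>
     photonic_crystal eps mu \<and> (\<forall>z. hermitian_posdef (eps z) \<and> hermitian_posdef (mu z))"

definition Linf_continuous :: "(real \<Rightarrow> medium) \<Rightarrow> bool" where
  "Linf_continuous h \<longleftrightarrow>
     (\<forall>t\<in>{0..1}. ((\<lambda>s. esssup lborel (\<lambda>z. ereal (norm (h s z - h t z)))) \<longlongrightarrow> 0)
                    (at t within {0..1}))"

text \<open>The first argument of \<open>h_eps\<close> and \<open>h_mu\<close> is the deformation parameter \<open>t\<close>, the
  second the position \<open>z\<close>.\<close>

definition continuous_deformation ::
    "(real \<Rightarrow> medium) \<Rightarrow> (real \<Rightarrow> medium) \<Rightarrow> bool" where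
  "continuous_deformation h_eps h_mu \<longleftrightarrow>
     (\<forall>t\<in>{0..1}. admissible (h_eps t) \<and> admissible (h_mu t)) \<and>
     Linf_continuous h_eps \<and> Linf_continuous h_mu"

section \<open>The first-order system and the monodromy matrix\<close>

definition block_mat :: "cmat2 \<Rightarrow> cmat2 \<Rightarrow> cmat2 \<Rightarrow> cmat2 \<Rightarrow> cmat4" where
  "block_mat A B C D = (\<chi> i j.
     (case i of
        Inl a \<Rightarrow> (case j of Inl b \<Rightarrow> A $ a $ b | Inr b \<Rightarrow> B $ a $ b)
      | Inr a \<Rightarrow> (case j of Inl b \<Rightarrow> C $ a $ b | Inr b \<Rightarrow> D $ a $ b)))"

definition Q2 :: cmat2 where
  "Q2 = vector [vector [0, -1], vector [1, 0]]"

definition Q4 :: cmat4 where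
  "Q4 = block_mat Q2 0 0 Q2"

definition A_mat :: "medium \<Rightarrow> medium \<Rightarrow> real \<Rightarrow> cmat4" where
  "A_mat eps mu z = mat \<i> ** block_mat 0 (mu z) (- eps z) 0"

definition coef :: "medium \<Rightarrow> medium \<Rightarrow> complex \<Rightarrow> real \<Rightarrow> cmat4" where
  "coef eps mu \<omega> z = mat \<omega> ** matrix_inv Q4 ** A_mat eps mu z"

text \<open>The coefficients may jump, so solutions are continuous functions that satisfy the equation
  classically off a locally finite set.\<close>

definition solves_ode ::
    "(real \<Rightarrow> 'a::real_normed_vector) \<Rightarrow> (real \<Rightarrow> 'a \<Rightarrow> 'a) \<Rightarrow> bool" where
  "solves_ode y F \<longleftrightarrow>
     continuous_on UNIV y \<and>
     (\<exists>S. locally_finite_set S \<and> (\<forall>z. z \<notin> S \<longrightarrow> (y has_vector_derivative F z (y z)) (at z)))"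

definition transfer_matrix ::
    "medium \<Rightarrow> medium \<Rightarrow> complex \<Rightarrow> real \<Rightarrow> real \<Rightarrow> cmat4" where
  "transfer_matrix eps mu \<omega> z z1 =
     (THE T. solves_ode T (\<lambda>z X. coef eps mu \<omega> z ** X) \<and> T z1 = mat 1) z"

definition monodromy :: "medium \<Rightarrow> medium \<Rightarrow> complex \<Rightarrow> cmat4" where
  "monodromy eps mu \<omega> = transfer_matrix eps mu \<omega> 1 0"

definition charpoly :: "complex^'n^'n \<Rightarrow> complex poly" where
  "charpoly M = det (\<chi> i j. (if i = j then [:0, 1:] else 0) - [:M $ i $ j:])"

text \<open>Eigenvalues, repeated according to algebraic multiplicity.\<close>

definition eigenvalue_mset :: "complex^'n^'n \<Rightarrow> complex multiset" where
  "eigenvalue_mset M = proots (charpoly M)"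

section \<open>Dispersion curves\<close>

definition quasiperiodic :: "real \<Rightarrow> (real \<Rightarrow> complex^'n) \<Rightarrow> bool" where
  "quasiperiodic k \<Phi> \<longleftrightarrow> (\<forall>z. \<Phi> (z + 1) = exp (\<i> * of_real k) *s \<Phi> z)"

definition eigenfrequency :: "medium \<Rightarrow> medium \<Rightarrow> real \<Rightarrow> complex \<Rightarrow> bool" where
  "eigenfrequency eps mu k \<omega> \<longleftrightarrow>
     (\<exists>\<Phi> :: real \<Rightarrow> cvec4. solves_ode \<Phi> (\<lambda>z v. coef eps mu \<omega> z *v v) \<and>
        quasiperiodic k \<Phi> \<and> (\<exists>z. \<Phi> z \<noteq> 0))"

definition dispersion_union :: "medium \<Rightarrow> medium \<Rightarrow> complex set" where
  "dispersion_union eps mu = {\<omega>. \<exists>k\<in>{-pi..pi}. eigenfrequency eps mu k \<omega>}"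

section \<open>Band gap of a Hermitian crystal\<close>

interpretation cfun: vector_space "\<lambda>(c::complex) (f :: real \<Rightarrow> complex^2) z. c *s f z"
  by unfold_locales (auto simp: fun_eq_iff vec_eq_iff algebra_simps)

text \<open>
  Writing \<open>\<Phi> = (E, H)\<close>, the first-order system reads \<open>Q E' = i \<omega> \<mu> H\<close>,
  \<open>Q H' = - i \<omega> \<epsilon> E\<close>. Eliminating \<open>H\<close> gives the second-order problem
  \<open>Q (\<mu>\<^sup>-\<^sup>1 Q E')' = \<lambda> \<epsilon> E\<close> with \<open>\<lambda> = \<omega>\<^sup>2\<close>, where both \<open>E\<close> and the flux
  \<open>G = \<mu>\<^sup>-\<^sup>1 Q E'\<close> are continuous and quasi-periodic. At \<open>\<lambda> = 0\<close> its multiplicity differs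
  from that of the first-order system.\<close>

definition electric_eigenspace ::
    "medium \<Rightarrow> medium \<Rightarrow> real \<Rightarrow> complex \<Rightarrow> (real \<Rightarrow> complex^2) set" where
  "electric_eigenspace eps mu k lam =
     {E. \<exists>G S.
        continuous_on UNIV E \<and> continuous_on UNIV G \<and>
        quasiperiodic k E \<and> quasiperiodic k G \<and> locally_finite_set S \<and>
        (\<forall>z. z \<notin> S \<longrightarrow> (\<exists>E' G'.
           (E has_vector_derivative E') (at z) \<and> (G has_vector_derivative G') (at z) \<and>
           G z = matrix_inv (mu z) *v (Q2 *v E') \<and>
           Q2 *v G' = lam *s (eps z *v E z)))}"

text \<open>\<open>w n k\<close> for \<open>n \<ge> 1\<close> lists in nondecreasing order the \<open>\<nu> \<ge> 0\<close> for which
  \<open>\<nu>\<^sup>2\<close> is an eigenvalue at \<open>k\<close>, each repeated according to its multiplicity. This determines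
  \<open>w n k\<close> uniquely; finiteness is stated because \<open>card\<close> of an infinite set is \<open>0\<close>.\<close>

definition band_functions :: "medium \<Rightarrow> medium \<Rightarrow> (nat \<Rightarrow> real \<Rightarrow> real) \<Rightarrow> bool" where
  "band_functions eps mu w \<longleftrightarrow>
     (\<forall>k\<in>{-pi..pi}.
        (\<forall>n\<ge>1. 0 \<le> w n k) \<and>
        (\<forall>m n. 1 \<le> m \<and> m \<le> n \<longrightarrow> w m k \<le> w n k) \<and>
        (\<forall>\<nu>\<ge>0. finite {n. 1 \<le> n \<and> w n k = \<nu>} \<and>
           card {n. 1 \<le> n \<and> w n k = \<nu>} =
             cfun.dim (electric_eigenspace eps mu k (of_real (\<nu>\<^sup>2)))))"

text \<open>\<open>k1\<close> maximises the \<open>n\<close>-th band and \<open>k2\<close> minimises the next one; the extrema exist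
  because the bands are continuous in \<open>k\<close>.\<close>

definition has_band_gap :: "medium \<Rightarrow> medium \<Rightarrow> bool" where
  "has_band_gap eps mu \<longleftrightarrow>
     (\<exists>w. band_functions eps mu w \<and>
        (\<exists>n\<ge>1. \<exists>k1\<in>{-pi..pi}. \<exists>k2\<in>{-pi..pi}.
           (\<forall>k\<in>{-pi..pi}. w n k \<le> w n k1) \<and>
           (\<forall>k\<in>{-pi..pi}. w (n + 1) k2 \<le> w (n + 1) k) \<and>
           w n k1 < w (n + 1) k2))"

section \<open>Index\<close>

definition index_at :: "medium \<Rightarrow> medium \<Rightarrow> complex \<Rightarrow> real" where
  "index_at eps mu \<omega> =
     (real (size (filter_mset (\<lambda>l. cmod l < 1) (eigenvalue_mset (monodromy eps mu \<omega>)))) -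
      real (size (filter_mset (\<lambda>l. cmod l > 1) (eigenvalue_mset (monodromy eps mu \<omega>))))) / 2"

definition Ind :: "medium \<Rightarrow> medium \<Rightarrow> complex set \<Rightarrow> real" where
  "Ind eps mu D = (THE r. \<forall>\<omega>\<in>D. index_at eps mu \<omega> = r)"

definition principal_gapped_component :: "medium \<Rightarrow> medium \<Rightarrow> complex set \<Rightarrow> bool" where
  "principal_gapped_component eps mu D \<longleftrightarrow>
     D \<in> components (- dispersion_union eps mu) \<and> Ind eps mu D = 0"

end

theory Submission
  imports Defs
begin

text \<open>The index depends only on the monodromy matrix, and it is locally constant as long as no
  multiplier lies on the unit circle. By Floquet theory this is the case along
  \<open>t \<mapsto> (t, g t)\<close> and on \<open>D\<close>, so the claim reduces to the index of the Hermitian medium at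
  \<open>g 0\<close>. At real frequencies the monodromy matrix preserves the energy flux, and at imaginary
  frequencies the flux with reflected magnetic field. Either invariant form pairs the multiplier
  \<open>a\<close> with \<open>1 / cnj a\<close>, which forces index zero. Since the spectrum of a Hermitian medium is
  real, every other frequency is joined to the imaginary axis by a horizontal segment that avoids
  the spectrum.\<close>

section \<open>Linear differential equations with locally finitely many jumps\<close>

text \<open>The coefficients jump, so growth, uniqueness and conservation along solutions all rest
  on the fundamental theorem of calculus with finitely many exceptional points, which asks for
  continuity there but for no derivative. The deformation is continuous only in an essential norm.
  At common points of continuity an essential bound is a pointwise bound, so closeness of media
  becomes closeness of coefficients off the jumps, the form that Gronwall's inequality can use.
  Neither invariant form works at every frequency. In a Hermitian medium the flux of a solution
  changes at the rate \<open>2 * Im \<omega>\<close> times a positive energy density: it is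
  conserved at real frequencies and strictly monotone at all others, which is also why the spectrum
  is real. Reversing the sign of one block of the form trades the real axis for the imaginary one,
  and a nonreal frequency can reach that axis with its imaginary part fixed. The index counts
  multiplicities, so the symmetry of the multipliers is derived from determinants and not from
  eigenvectors.\<close>

lemma locally_finite_set_Un:
  "locally_finite_set S \<Longrightarrow> locally_finite_set T \<Longrightarrow> locally_finite_set (S \<union> T)"
  by (auto simp: locally_finite_set_def Int_Un_distrib2)

lemma locally_finite_set_image:
  assumes "locally_finite_set S" "inj f" "\<And>a b. \<exists>c d. f -` {a..b} \<subseteq> {c..d}"
  shows "locally_finite_set (f ` S)"
  unfolding locally_finite_set_def
proof (intro allI)
  fix a b
  obtain c d where cd: "f -` {a..b} \<subseteq> {c..d}" using assms(3) by blast
  have "f ` S \<inter> {a..b} \<subseteq> f ` (S \<inter> {c..d})" using cd by auto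
  moreover have "finite (f ` (S \<inter> {c..d}))"
    using assms(1) by (simp add: locally_finite_set_def)
  ultimately show "finite (f ` S \<inter> {a..b})" by (rule finite_subset)
qed

lemma locally_finite_set_shift: "locally_finite_set S \<Longrightarrow> locally_finite_set ((\<lambda>x. x + c) ` S)"
proof (erule locally_finite_set_image)
  show "\<exists>u v. (\<lambda>x. x + c) -` {a..b} \<subseteq> {u..v}" for a b :: real
    by (rule exI[of _ "a-c"], rule exI[of _ "b-c"]) auto
qed (simp add: inj_def)

lemma locally_finite_set_countable:
  assumes "locally_finite_set S" shows "countable S"
proof -
  have "S = (\<Union>n::nat. S \<inter> {- real n..real n})"
  proof
    show "S \<subseteq> (\<Union>n::nat. S \<inter> {- real n..real n})"
    proof
      fix x assume "x \<in> S"
      obtain n where "\<bar>x\<bar> \<le> real n" using real_arch_simple by blast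
      then have "x \<in> S \<inter> {- real n..real n}" using \<open>x \<in> S\<close> by auto
      then show "x \<in> (\<Union>n::nat. S \<inter> {- real n..real n})" by blast
    qed
  qed auto
  moreover have "countable (\<Union>n::nat. S \<inter> {- real n..real n})"
    by (rule countable_UN) (use assms in \<open>auto simp: locally_finite_set_def intro!: countable_finite\<close>)
  ultimately show ?thesis by simp
qed

text \<open>A locally finite set is countable and a nonempty open set of reals is not. This provides
  points arbitrarily near a given one at which the equation holds.\<close>

lemma locally_finite_set_avoid:
  assumes "locally_finite_set S" "open U" "U \<noteq> {}"
  shows "\<exists>z\<in>U. z \<notin> S"
proof (rule ccontr)
  assume "\<not> ?thesis"
  then have "U \<subseteq> S" by auto
  then have "countable U" using locally_finite_set_countable[OF assms(1)] countable_subset by blast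
  then show False using assms(2,3) 
    by (metis all_not_in_conv open_contains_ball countable_subset uncountable_ball)
qed

section \<open>Monotonicity, growth estimates and uniqueness across jumps\<close>

lemma nonincreasing_off_finite:
  fixes f :: "real \<Rightarrow> real"
  assumes "finite S" "a \<le> b" "continuous_on {a..b} f"
    and "\<And>x. x \<in> {a<..<b} - S \<Longrightarrow> (f has_vector_derivative f' x) (at x)"
    and "\<And>x. x \<in> {a<..<b} - S \<Longrightarrow> f' x \<le> 0"
  shows "f b \<le> f a"
proof -
  \<comment> \<open>The derivative is not given on \<open>S\<close> and at the end points. Any value
    there leaves the integral unchanged; 0 also respects the sign condition.\<close>
  define k where "k x = (if x \<in> {a<..<b} - S then f' x else 0)" for x
  have "(k has_integral (f b - f a)) {a..b}"
    by (rule fundamental_theorem_of_calculus_interior_strong[OF assms(1,2)])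
       (use assms in \<open>auto simp: k_def\<close>)
  moreover have "k x \<le> 0" for x using assms(5) by (auto simp: k_def)
  ultimately have "f b - f a \<le> 0" 
    using has_integral_nonneg[OF has_integral_neg[of k "f b - f a" "{a..b}"]] by force
  then show ?thesis by simp
qed

lemma norm_increment_le_off_finite:
  fixes f :: "real \<Rightarrow> 'a::euclidean_space"
  assumes "finite S" "a \<le> b" "continuous_on {a..b} f" "continuous_on {a..b} \<phi>"
    and "\<And>x. x \<in> {a<..<b} - S \<Longrightarrow> (f has_vector_derivative f' x) (at x)"
    and "\<And>x. x \<in> {a<..<b} - S \<Longrightarrow> (\<phi> has_vector_derivative \<phi>' x) (at x)"
    and "\<And>x. x \<in> {a<..<b} - S \<Longrightarrow> norm (f' x) \<le> \<phi>' x"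
  shows "norm (f b - f a) \<le> \<phi> b - \<phi> a"
proof -
  define k where "k x = (if x \<in> {a<..<b} - S then f' x else 0)" for x
  define l where "l x = (if x \<in> {a<..<b} - S then \<phi>' x else 0)" for x
  have k: "(k has_integral (f b - f a)) {a..b}"
    by (rule fundamental_theorem_of_calculus_interior_strong[OF assms(1,2)])
       (use assms in \<open>auto simp: k_def\<close>)
  have l: "(l has_integral (\<phi> b - \<phi> a)) {a..b}"
    by (rule fundamental_theorem_of_calculus_interior_strong[OF assms(1,2)])
       (use assms in \<open>auto simp: l_def\<close>)
  have "norm (integral {a..b} k) \<le> integral {a..b} l"
    by (rule integral_norm_bound_integral) (use k l assms(7) in \<open>auto simp: k_def l_def\<close>)
  then show ?thesis using k l by (simp add: integral_unique)
qed

text \<open>The squared norm is differentiable even where \<open>y\<close> vanishes. In its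
  derivative the forcing is absorbed by
  \<open>2 * norm (y x) * \<eta> \<le> (norm (y x))^2 + \<eta>^2\<close>, which explains the rate
  \<open>2 * K + 1\<close>; adding \<open>\<eta>^2\<close> to the square closes the estimate and
  makes the weighted quantity nonincreasing. Its initial value is \<open>\<eta>^2\<close>, and the
  final square root halves the exponent.\<close>

lemma gronwall:
  fixes y :: "real \<Rightarrow> 'a::real_inner"
  assumes S: "finite S" and ab: "a \<le> b" and cont: "continuous_on {a..b} y"
    and der: "\<And>x. x \<in> {a<..<b} - S \<Longrightarrow> (y has_vector_derivative y' x) (at x)"
    and bound: "\<And>x. x \<in> {a<..<b} - S \<Longrightarrow> norm (y' x) \<le> K * norm (y x) + \<eta>"
    and K: "K \<ge> 0" and \<eta>: "\<eta> \<ge> 0" and ya: "y a = 0"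
  shows "norm (y b) \<le> \<eta> * exp ((2*K+1)*(b-a)/2)"
proof -
  define \<phi> where "\<phi> x = (y x \<bullet> y x + \<eta>\<^sup>2) * exp (-((2*K+1)*(x-a)))" for x
  define \<phi>' where "\<phi>' x = (2 * (y x \<bullet> y' x) - (2*K+1) * (y x \<bullet> y x + \<eta>\<^sup>2)) *
     exp (-((2*K+1)*(x-a)))" for x
  have "\<phi> b \<le> \<phi> a"
  proof (rule nonincreasing_off_finite[OF S ab])
    show "continuous_on {a..b} \<phi>" unfolding \<phi>_def by (intro continuous_intros cont)
  next
    fix x assume x: "x \<in> {a<..<b} - S"
    have "((\<lambda>x. y x \<bullet> y x) has_real_derivative 2 * (y x \<bullet> y' x)) (at x)"
    proof -
      have "(y has_derivative (\<lambda>h. h *\<^sub>R y' x)) (at x)"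
        using der[OF x] by (simp add: has_vector_derivative_def)
      from has_derivative_inner[OF this this] show ?thesis
        by (simp add: has_field_derivative_def inner_commute algebra_simps mult_commute_abs)
    qed
    then have "(\<phi> has_real_derivative \<phi>' x) (at x)"
      unfolding \<phi>_def \<phi>'_def by (auto intro!: derivative_eq_intros simp: algebra_simps)
    then show "(\<phi> has_vector_derivative \<phi>' x) (at x)"
      by (simp add: has_real_derivative_iff_has_vector_derivative)
    have "y x \<bullet> y' x \<le> norm (y x) * norm (y' x)" by (rule norm_cauchy_schwarz)
    also have "\<dots> \<le> norm (y x) * (K * norm (y x) + \<eta>)"
      by (intro mult_left_mono bound x) auto
    finally have "2 * (y x \<bullet> y' x) \<le> 2 * K * (norm (y x))\<^sup>2 + 2 * norm (y x) * \<eta>"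
      by (simp add: algebra_simps power2_eq_square)
    also have "2 * norm (y x) * \<eta> \<le> (norm (y x))\<^sup>2 + \<eta>\<^sup>2"
      using sum_squares_bound by blast
    also have "2 * K * (norm (y x))\<^sup>2 + ((norm (y x))\<^sup>2 + \<eta>\<^sup>2) \<le> (2*K+1) * ((norm (y x))\<^sup>2 + \<eta>\<^sup>2)"
      using K by (simp add: algebra_simps)
    finally show "\<phi>' x \<le> 0"
      unfolding \<phi>'_def by (intro mult_nonpos_nonneg) (auto simp: power2_norm_eq_inner)
  qed
  then have "(norm (y b))\<^sup>2 * exp (-((2*K+1)*(b-a))) + \<eta>\<^sup>2 * exp (-((2*K+1)*(b-a))) \<le> \<eta>\<^sup>2"
    using ya by (simp add: \<phi>_def power2_norm_eq_inner algebra_simps)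
  then have "(norm (y b))\<^sup>2 * exp (-((2*K+1)*(b-a))) \<le> \<eta>\<^sup>2"
    by (smt (verit) exp_ge_zero mult_nonneg_nonneg zero_le_power2)
  then have "(norm (y b))\<^sup>2 \<le> \<eta>\<^sup>2 * exp ((2*K+1)*(b-a))"
    by (simp only: exp_minus divide_inverse[symmetric] pos_divide_le_eq exp_gt_zero)
  also have "\<dots> = (\<eta> * exp ((2*K+1)*(b-a)/2))\<^sup>2"
    by (simp add: power_mult_distrib exp_double[symmetric])
  finally show ?thesis by (rule power2_le_imp_le) (use \<eta> in simp)
qed

text \<open>Gronwall's inequality without forcing; points before \<open>a\<close> are reached by
  reversing the direction of \<open>z\<close>.\<close>

lemma solves_ode_unique_zero:
  fixes y :: "real \<Rightarrow> 'a::real_inner"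
  assumes S: "locally_finite_set S" and cont: "continuous_on UNIV y"
    and der: "\<And>z. z \<notin> S \<Longrightarrow> (y has_vector_derivative y' z) (at z)"
    and bound: "\<And>z. z \<notin> S \<Longrightarrow> norm (y' z) \<le> K * norm (y z)"
    and y0: "y a = 0"
  shows "y z = 0"
proof -
  \<comment> \<open>\<open>K\<close> may be negative, while Gronwall's inequality asks for a
    nonnegative rate.\<close>
  have K': "norm (y' z) \<le> max K 0 * norm (y z) + 0" if "z \<notin> S" for z
    using bound[OF that] by (smt (verit, best) max_def mult_right_mono norm_ge_zero)
  show ?thesis
  proof (cases "a \<le> z")
    case True
    have "norm (y z) \<le> 0 * exp ((2*max K 0+1)*(z-a)/2)"
      by (rule gronwall[where S = "S \<inter> {a..z}" and y' = y'])
         (use True S K' der y0 in \<open>auto simp: locally_finite_set_def intro: continuous_on_subset[OF cont]\<close>)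
    then show ?thesis by simp
  next
    case False
    have "norm ((\<lambda>x. y (-x)) (-z)) \<le> 0 * exp ((2*max K 0+1)*(-z-(-a))/2)"
    proof (rule gronwall[where S = "uminus ` (S \<inter> {z..a})" and y' = "\<lambda>x. - y' (-x)"])
      show "finite (uminus ` (S \<inter> {z..a}))" using S by (auto simp: locally_finite_set_def)
      show "continuous_on {-a..-z} (\<lambda>x. y (-x))"
        by (intro continuous_on_compose2[OF cont] continuous_intros) auto
      fix x assume x: "x \<in> {-a<..<-z} - uminus ` (S \<inter> {z..a})"
      then have "- x \<in> {z..a}" by auto
      moreover have "- x \<notin> S \<inter> {z..a}"
      proof
        assume "- x \<in> S \<inter> {z..a}"
        then have "- (- x) \<in> uminus ` (S \<inter> {z..a})" by (rule imageI)
        then show False using x by simp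
      qed
      ultimately have "- x \<notin> S" by blast
      show "((\<lambda>x. y (-x)) has_vector_derivative - y' (-x)) (at x)"
      proof -
        have "(y \<circ> uminus has_vector_derivative (-1) *\<^sub>R y' (-x)) (at x)"
          by (rule vector_diff_chain_at)
             (use der[OF \<open>-x \<notin> S\<close>] in \<open>auto intro!: derivative_eq_intros\<close>)
        then show ?thesis by (simp add: o_def)
      qed
      show "norm (- y' (-x)) \<le> max K 0 * norm (y (-x)) + 0"
        using K'[OF \<open>-x \<notin> S\<close>] by simp
    qed (use False y0 in auto)
    then show ?thesis by simp
  qed
qed

section \<open>Integration of piecewise continuous fields and Picard iteration\<close>

lemma bounded_off_finite_integrable:
  fixes g :: "real \<Rightarrow> 'a::euclidean_space"
  assumes S: "locally_finite_set S" and cont: "\<And>z. z \<notin> S \<Longrightarrow> isCont g z"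
    and bdd: "bounded (g ` {a..b})"
  shows "g integrable_on {a..b}"
proof -
  obtain B where B: "\<And>x. x \<in> {a..b} \<Longrightarrow> norm (g x) \<le> B"
    using bdd unfolding bounded_iff by blast
  show ?thesis
  proof (rule measurable_bounded_by_integrable_imp_integrable)
    have "g \<in> borel_measurable borel"
      by (rule borel_measurable_continuous_countable_exceptions[OF locally_finite_set_countable[OF S]])
         (auto intro!: continuous_at_imp_continuous_on cont)
    then have "g \<in> borel_measurable lborel" by simp
    then have "g \<in> borel_measurable lebesgue" by (rule measurable_completion)
    then show "g \<in> borel_measurable (lebesgue_on {a..b})" by (rule measurable_restrict_space1)
    show "(\<lambda>_. B) integrable_on {a..b}" by auto
  qed (use B in auto)
qed

text \<open>One of the two integrals is always over an empty or one-point interval, hence 0; the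
  difference is the signed integral from 0 to \<open>z\<close>.\<close>

definition primitive :: "(real \<Rightarrow> 'a::euclidean_space) \<Rightarrow> real \<Rightarrow> 'a" where
  "primitive g z = integral {0..z} g - integral {z..0} g"

lemma primitive_0 [simp]: "primitive g 0 = 0"
  by (simp add: primitive_def)

lemma
  fixes g :: "real \<Rightarrow> 'a::euclidean_space"
  assumes S: "locally_finite_set S" and cont: "\<And>z. z \<notin> S \<Longrightarrow> isCont g z"
    and bdd: "\<And>a b. bounded (g ` {a..b})"
  shows primitive_continuous: "continuous_on UNIV (primitive g)"
    and primitive_derivative: "z \<notin> S \<Longrightarrow> (primitive g has_vector_derivative g z) (at z)"
proof -
  have int: "g integrable_on {a..b}" for a b
    by (rule bounded_off_finite_integrable[OF S cont bdd])
  \<comment> \<open>A base point to the left of both 0 and \<open>z\<close> leaves a single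
    indefinite integral, so continuity and derivative need no case distinction at 0.\<close>
  have eq: "primitive g z = integral {-R..z} g - integral {-R..0} g" if "\<bar>z\<bar> \<le> R" for z R
  proof (cases "0 \<le> z")
    case True
    have "integral {-R..0} g + integral {0..z} g = integral {-R..z} g"
      by (rule Henstock_Kurzweil_Integration.integral_combine) (use True that int in auto)
    moreover have "integral {z..0} g = 0" using True by (cases "z = 0") auto
    ultimately show ?thesis by (simp add: primitive_def algebra_simps)
  next
    case False
    have "integral {-R..z} g + integral {z..0} g = integral {-R..0} g"
      by (rule Henstock_Kurzweil_Integration.integral_combine) (use False that int in auto)
    then show ?thesis using False by (simp add: primitive_def algebra_simps)
  qed
  have nhd: "z \<in> {-(\<bar>z\<bar>+1)<..<\<bar>z\<bar>+1}" for z :: real by auto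
  have "isCont (primitive g) z" for z
  proof -
    have "continuous_on {-(\<bar>z\<bar>+1)..\<bar>z\<bar>+1}
        (\<lambda>x. integral {-(\<bar>z\<bar>+1)..x} g - integral {-(\<bar>z\<bar>+1)..0} g)"
      by (intro continuous_intros indefinite_integral_continuous_1 int)
    then have "continuous_on {-(\<bar>z\<bar>+1)..\<bar>z\<bar>+1} (primitive g)"
      by (rule continuous_on_eq) (subst eq[of _ "\<bar>z\<bar>+1"], auto)
    then show ?thesis
      by (rule continuous_on_interior) (use nhd in auto)
  qed
  then show "continuous_on UNIV (primitive g)" by (simp add: continuous_on_eq_continuous_at)
  assume z: "z \<notin> S"
  define R where "R = \<bar>z\<bar> + 1"
  have "((\<lambda>u. integral {-R..u} g) has_vector_derivative g z) (at z within ({-R..R} - {}))"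
    by (rule integral_has_vector_derivative_continuous_at)
       (use z cont int in \<open>auto simp: R_def intro: continuous_at_imp_continuous_within\<close>)
  then have "((\<lambda>u. integral {-R..u} g) has_vector_derivative g z) (at z)"
    using at_within_interior[of z "{-R..R}"] nhd[of z] by (simp add: R_def)
  then have "((\<lambda>u. integral {-R..u} g - integral {-R..0} g) has_vector_derivative g z) (at z)"
    by (auto intro!: derivative_eq_intros)
  then show "(primitive g has_vector_derivative g z) (at z)"
  proof (rule has_vector_derivative_transform_within_open)
    show "open {-R<..<R}" "z \<in> {-R<..<R}" by (auto simp: R_def)
    show "integral {-R..x} g - integral {-R..0} g = primitive g x" if "x \<in> {-R<..<R}" for x
      using eq[of x R] that by auto
  qed
qed

text \<open>The exponential weight makes the integral operator of a system bounded by \<open>K\<close>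
  a contraction with factor one half.\<close>

lemma norm_le_exp_weight:
  fixes G :: "real \<Rightarrow> 'a::euclidean_space"
  assumes S: "locally_finite_set S" and cont: "continuous_on UNIV G"
    and der: "\<And>z. z \<notin> S \<Longrightarrow> (G has_vector_derivative g z) (at z)"
    and bound: "\<And>z. z \<notin> S \<Longrightarrow> norm (g z) \<le> 2 * K * A * exp (2 * K * \<bar>z\<bar>)"
    and A: "A \<ge> 0" and G0: "G 0 = 0"
  shows "norm (G z) \<le> A * exp (2 * K * \<bar>z\<bar>)"
proof (cases "0 \<le> z")
  case True
  have w: "continuous_on {0..z} (\<lambda>z. A * exp (2 * K * z))" by (intro continuous_intros)
  have "norm (G z - G 0) \<le> A * exp (2 * K * z) - A * exp (2 * K * 0)"
  proof (rule norm_increment_le_off_finite[where S = "S \<inter> {0..z}"])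
    show "((\<lambda>z. A * exp (2*K*z)) has_vector_derivative 2 * K * A * exp (2*K*x)) (at x)" for x
      unfolding has_real_derivative_iff_has_vector_derivative[symmetric]
      by (auto intro!: derivative_eq_intros)
    show "norm (g x) \<le> 2 * K * A * exp (2*K*x)" if "x \<in> {0<..<z} - S \<inter> {0..z}" for x
      using bound[of x] that by auto
  qed (use True S der in \<open>auto simp: locally_finite_set_def intro: w continuous_on_subset[OF cont]\<close>)
  then show ?thesis using A True G0 by simp
next
  case False
  have w: "continuous_on {z..0} (\<lambda>z. - (A * exp (-(2 * K * z))))" by (intro continuous_intros)
  have "norm (G 0 - G z) \<le> - A * exp (-(2 * K * 0)) - (- A * exp (-(2 * K * z)))"
  proof (rule norm_increment_le_off_finite[where S = "S \<inter> {z..0}" and f = G])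
    show "((\<lambda>z. - A * exp (-(2*K*z))) has_vector_derivative 2 * K * A * exp (-(2*K*x))) (at x)" for x
      unfolding has_real_derivative_iff_has_vector_derivative[symmetric]
      by (auto intro!: derivative_eq_intros)
    show "norm (g x) \<le> 2 * K * A * exp (-(2*K*x))" if "x \<in> {z<..<0} - S \<inter> {z..0}" for x
      using bound[of x] that by auto
  qed (use False S der in \<open>auto simp: locally_finite_set_def intro: w continuous_on_subset[OF cont]\<close>)
  then show ?thesis using A False G0 by simp
qed

text \<open>Continuity is known only for each fixed vector. The uniform bound controls the moving
  argument: \<open>F w (y w)\<close> splits into \<open>F w (y w - y z)\<close>, which tends to 0,
  and \<open>F w (y z)\<close>.\<close>

lemma linear_field_isCont:
  fixes F :: "real \<Rightarrow> 'a::real_normed_vector \<Rightarrow> 'a"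
  assumes lin: "\<And>z. linear (F z)" and bound: "\<And>z x. norm (F z x) \<le> K * norm x"
    and F: "\<And>x. isCont (\<lambda>z. F z x) z" and y: "isCont y z"
  shows "isCont (\<lambda>z. F z (y z)) z"
proof -
  have "((\<lambda>w. K * norm (y w - y z)) \<longlongrightarrow> K * norm (y z - y z)) (at z)"
    using y by (intro tendsto_intros) (simp add: isCont_def)
  then have "((\<lambda>w. K * norm (y w - y z)) \<longlongrightarrow> 0) (at z)" by simp
  then have "((\<lambda>w. F w (y w - y z)) \<longlongrightarrow> 0) (at z)"
    by (rule Lim_null_comparison[rotated]) (simp add: bound)
  then have "((\<lambda>w. F w (y w - y z) + F w (y z)) \<longlongrightarrow> 0 + F z (y z)) (at z)"
    using F[of "y z"] by (intro tendsto_add) (auto simp: isCont_def)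
  moreover have "F w (y w - y z) + F w (y z) = F w (y w)" for w
    using linear_diff[OF lin] by simp
  ultimately show ?thesis by (simp add: isCont_def)
qed

text \<open>Picard iteration as a Neumann series: the solution is the sum of the iterated integrals
  of the constant \<open>x0\<close>. Under the weight \<open>exp (2 * K * \<bar>z\<bar>)\<close> the
  bound is halved from each term to the next, so the series converges on the whole line at once,
  without continuing local solutions.\<close>

lemma linear_ode_exists:
  fixes F :: "real \<Rightarrow> 'a::euclidean_space \<Rightarrow> 'a"
  assumes S: "locally_finite_set S" and lin: "\<And>z. linear (F z)"
    and bound: "\<And>z x. norm (F z x) \<le> K * norm x" and K: "K > 0"
    and cont: "\<And>z x. z \<notin> S \<Longrightarrow> isCont (\<lambda>z. F z x) z"
  shows "\<exists>y. solves_ode y F \<and> y 0 = x0"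
proof -
  define P where "P y = primitive (\<lambda>z. F z (y z))" for y
  have bddF: "bounded ((\<lambda>z. F z (y z)) ` {a..b})" if "continuous_on UNIV y" for y a b
  proof -
    have "bounded (y ` {a..b})"
      by (intro compact_imp_bounded compact_continuous_image continuous_on_subset[OF that]) auto
    then obtain B where "\<And>z. z \<in> {a..b} \<Longrightarrow> norm (y z) \<le> B" unfolding bounded_iff by blast
    then have "norm (F z (y z)) \<le> K * B" if "z \<in> {a..b}" for z
      using order_trans[OF bound[of z "y z"] mult_left_mono[of "norm (y z)" B K]] K that by simp
    then show ?thesis by (intro boundedI[of _ "K * B"]) (auto simp only: image_iff)
  qed
  have contF: "isCont (\<lambda>z. F z (y z)) z" if "continuous_on UNIV y" "z \<notin> S" for y z
    by (rule linear_field_isCont[OF lin bound cont])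
       (use that in \<open>auto simp: continuous_on_eq_continuous_at\<close>)
  have Pcont: "continuous_on UNIV (P y)" if "continuous_on UNIV y" for y
    unfolding P_def by (rule primitive_continuous[OF S contF[OF that] bddF[OF that]])
  have Pder: "(P y has_vector_derivative F z (y z)) (at z)"
    if "continuous_on UNIV y" "z \<notin> S" for y z
    unfolding P_def by (rule primitive_derivative[OF S contF[OF that(1)] bddF[OF that(1)] that(2)])
  have P0: "P y 0 = 0" for y by (simp add: P_def)
  define X where "X n = (P ^^ n) (\<lambda>_. x0)" for n
  define E where "E z = exp (2 * K * \<bar>z\<bar>)" for z :: real
  have Xcont: "continuous_on UNIV (X n)" for n
    by (induction n) (auto simp: X_def intro: Pcont)
  have XS: "X (Suc n) = P (X n)" for n by (simp add: X_def)
  have Xbound: "norm (X n z) \<le> norm x0 * (1/2)^n * E z" for n z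
  proof (induction n arbitrary: z)
    case 0
    have "1 \<le> E z" using K by (simp add: E_def)
    then show ?case by (simp add: X_def mult_le_cancel_left1)
  next
    case (Suc n)
    have "norm (P (X n) z) \<le> norm x0 * (1/2)^Suc n * exp (2 * K * \<bar>z\<bar>)"
    proof (rule norm_le_exp_weight[OF S Pcont[OF Xcont] Pder[OF Xcont] _ _ P0])
      fix w
      have "norm (F w (X n w)) \<le> K * (norm x0 * (1/2)^n * E w)"
        using bound[of w "X n w"] mult_left_mono[OF Suc[of w], of K] K by linarith
      then show "norm (F w (X n w)) \<le> 2 * K * (norm x0 * (1/2)^Suc n) * exp (2 * K * \<bar>w\<bar>)"
        by (simp add: E_def)
    qed auto
    then show ?case by (simp add: XS E_def)
  qed
  define T where "T z = (\<Sum>n. X n z)" for z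
  have summ: "summable (\<lambda>n. X n z)" for z
    by (rule summable_comparison_test[of _ "\<lambda>n. norm x0 * (1/2)^n * E z"])
       (auto intro!: Xbound summable_mult summable_mult2 summable_geometric)
  have tail: "norm (T z - (\<Sum>k<n. X k z)) \<le> 2 * norm x0 * (1/2)^n * E z" for n z
  proof -
    have sg: "summable (\<lambda>k. norm x0 * (1/2)^(k+n) * E z)"
      by (auto simp: power_add intro!: summable_mult summable_mult2 summable_geometric)
    have "T z - (\<Sum>k<n. X k z) = (\<Sum>k. X (k+n) z)"
      unfolding T_def using suminf_split_initial_segment[OF summ, of z n] by simp
    also have "norm \<dots> \<le> (\<Sum>k. norm x0 * (1/2)^(k+n) * E z)"
      by (rule norm_suminf_le) (use sg Xbound in auto)
    also have "\<dots> = norm x0 * (1/2)^n * E z * (\<Sum>k. (1/2)^k)"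
      by (subst suminf_mult[symmetric]) (auto simp: power_add mult_ac summable_geometric)
    also have "(\<Sum>k. (1/2::real)^k) = 2" by (simp add: suminf_geometric)
    finally show ?thesis by (simp add: mult_ac)
  qed
  have half: "(\<lambda>n. C * (1/2)^n * e) \<longlonglongrightarrow> 0" for C e :: real
    by (auto intro!: tendsto_mult_right_zero tendsto_mult_left_zero LIMSEQ_realpow_zero)
  have Tcont: "continuous_on UNIV T"
  proof -
    \<comment> \<open>The weight is unbounded, so the convergence is shown to be uniform on bounded
      intervals only.\<close>
    have "continuous_on {-R<..<R} T" for R
    proof (rule uniform_limit_theorem)
      show "\<forall>\<^sub>F n in sequentially. continuous_on {-R<..<R} (\<lambda>z. \<Sum>k<n. X k z)"
        by (intro always_eventually allI continuous_intros continuous_on_subset[OF Xcont]) auto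
      show "uniform_limit {-R<..<R} (\<lambda>n z. \<Sum>k<n. X k z) T sequentially"
      proof (rule uniform_limitI)
        fix e :: real assume "e > 0"
        have "\<forall>\<^sub>F n in sequentially. 2 * norm x0 * (1/2)^n * E R < e"
          using half[of "2 * norm x0" "E R"] \<open>e > 0\<close> by (simp add: order_tendsto_iff)
        then show "\<forall>\<^sub>F n in sequentially. \<forall>z\<in>{-R<..<R}. dist (\<Sum>k<n. X k z) (T z) < e"
        proof (rule eventually_mono, intro ballI)
          fix n z assume n: "2 * norm x0 * (1/2)^n * E R < e" and "z \<in> {-R<..<R}"
          then have "E z \<le> E R" using K by (auto simp: E_def)
          then have "2 * norm x0 * (1/2)^n * E z \<le> 2 * norm x0 * (1/2)^n * E R"
            by (intro mult_left_mono) auto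
          then show "dist (\<Sum>k<n. X k z) (T z) < e"
            using tail[of z n] n by (simp add: dist_norm norm_minus_commute)
        qed
      qed
    qed simp
    then have "isCont T z" for z
    proof -
      have "z \<in> {-(\<bar>z\<bar>+1)<..<\<bar>z\<bar>+1}" by auto
      then show ?thesis using \<open>continuous_on {-(\<bar>z\<bar>+1)<..<\<bar>z\<bar>+1} T\<close>
        by (simp only: continuous_on_eq_continuous_at open_greaterThanLessThan)
    qed
    then show ?thesis by (simp add: continuous_on_eq_continuous_at)
  qed
  \<comment> \<open>\<open>P T\<close> minus the image of a partial sum is the integral of
    \<open>F\<close> applied to the tail, so the weight halves the tail bound. Hence
    \<open>P\<close> may be applied to the series term by term.\<close>
  have fix1: "norm (P T z - (\<Sum>k<n. X (Suc k) z)) \<le> norm x0 * (1/2)^n * E z" for n z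
  proof -
    have "norm ((\<lambda>z. P T z - (\<Sum>k<n. P (X k) z)) z) \<le> norm x0 * (1/2)^n * exp (2 * K * \<bar>z\<bar>)"
    proof (rule norm_le_exp_weight[OF S])
      show "continuous_on UNIV (\<lambda>z. P T z - (\<Sum>k<n. P (X k) z))"
        by (intro continuous_intros Pcont Tcont Xcont)
      fix w assume w: "w \<notin> S"
      show "((\<lambda>z. P T z - (\<Sum>k<n. P (X k) z)) has_vector_derivative
              F w (T w - (\<Sum>k<n. X k w))) (at w)"
      proof -
        have "((\<lambda>z. P T z - (\<Sum>k<n. P (X k) z)) has_vector_derivative
              F w (T w) - (\<Sum>k<n. F w (X k w))) (at w)"
          by (intro derivative_intros Pder Tcont Xcont w)
        then show ?thesis by (simp add: linear_diff[OF lin] linear_sum[OF lin])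
      qed
      have "norm (F w (T w - (\<Sum>k<n. X k w))) \<le> K * (2 * norm x0 * (1/2)^n * E w)"
        using bound[of w "T w - (\<Sum>k<n. X k w)"] mult_left_mono[OF tail[of w n], of K] K by linarith
      then show "norm (F w (T w - (\<Sum>k<n. X k w))) \<le> 2 * K * (norm x0 * (1/2)^n) * exp (2 * K * \<bar>w\<bar>)"
        by (simp add: E_def mult_ac)
    qed (auto simp: P0)
    then show ?thesis by (simp add: XS E_def)
  qed
  have T_eq: "T z = x0 + P T z" for z
  proof -
    have "(\<lambda>n. P T z - (\<Sum>k<n. X (Suc k) z)) \<longlonglongrightarrow> 0"
      by (rule Lim_null_comparison[OF _ half[of "norm x0" "E z"]]) (use fix1 in auto)
    moreover have "(\<lambda>n. P T z - (\<Sum>k<n. X (Suc k) z)) \<longlonglongrightarrow> P T z - (\<Sum>k. X (Suc k) z)"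
      by (intro tendsto_intros summable_LIMSEQ, subst summable_Suc_iff, rule summ)
    ultimately have "P T z - (\<Sum>k. X (Suc k) z) = 0" by (rule LIMSEQ_unique[symmetric])
    then have "P T z = (\<Sum>k. X (Suc k) z)" by simp
    moreover have "T z = X 0 z + (\<Sum>k. X (Suc k) z)"
      unfolding T_def using suminf_split_head[OF summ] by simp
    ultimately show ?thesis by (simp add: X_def)
  qed
  have "(T has_vector_derivative F z (T z)) (at z)" if "z \<notin> S" for z
  proof -
    have "((\<lambda>z. x0 + P T z) has_vector_derivative 0 + F z (T z)) (at z)"
      by (intro derivative_intros Pder Tcont that)
    moreover have "(\<lambda>z. x0 + P T z) = T" using T_eq by (rule ext[OF sym])
    ultimately show ?thesis by simp
  qed
  moreover have "T 0 = x0" using T_eq[of 0] unfolding P0 by simp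
  ultimately show ?thesis using Tcont S unfolding solves_ode_def
    by (intro exI[of _ T] conjI exI[of _ S]) auto
qed

section \<open>Eigenvalue multisets\<close>

lemma poly_charpoly: "poly (charpoly M) x = det (mat x - M)"
proof -
  have "poly (charpoly M) x = (\<Sum>p | p permutes UNIV. of_int (sign p) *
      (\<Prod>i\<in>UNIV. poly ((if i = p i then [:0, 1:] else 0) - [:M $ i $ p i:]) x))"
    unfolding charpoly_def det_def by (simp add: poly_sum poly_prod)
  also have "\<dots> = det (mat x - M)"
    unfolding det_def mat_def
    by (intro sum.cong prod.cong refl arg_cong2[where f = "(*)"]) auto
  finally show ?thesis .
qed

text \<open>Off-diagonal entries are constants, so the term of a permutation has degree at most its
  number of fixed points; only the identity reaches the top degree.\<close>

lemma
  fixes M :: "complex^'n^'n"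
  shows degree_charpoly: "degree (charpoly M) = CARD('n)"
    and lead_coeff_charpoly: "lead_coeff (charpoly M) = 1"
proof -
  define e where "e i j = (if i = j then [:0, 1:] else 0) - [:M $ i $ j:]" for i j
  define t where "t p = of_int (sign p) * (\<Prod>i\<in>UNIV. e i (p i))" for p
  have cp: "charpoly M = (\<Sum>p | p permutes UNIV. t p)"
    unfolding charpoly_def det_def e_def t_def by simp
  have dt: "degree (t p) \<le> card {i. p i = i}" for p
  proof -
    have "degree (t p) \<le> degree (of_int (sign p) :: complex poly) + degree (\<Prod>i\<in>UNIV. e i (p i))"
      unfolding t_def by (rule degree_mult_le)
    also have "\<dots> = degree (\<Prod>i\<in>UNIV. e i (p i))" by simp
    also have "\<dots> \<le> (\<Sum>i\<in>UNIV. degree (e i (p i)))"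
      using degree_prod_sum_le[of UNIV "\<lambda>i. e i (p i)"] by (simp add: o_def)
    also have "\<dots> \<le> (\<Sum>i\<in>UNIV. if p i = i then 1 else 0)"
      by (rule sum_mono) (auto simp: e_def)
    also have "\<dots> = card {i. p i = i}" by (simp add: sum.If_cases)
    finally show ?thesis .
  qed
  have less: "degree (t p) < CARD('n)" if "p \<noteq> id" for p
  proof -
    have "{i. p i = i} \<subset> UNIV" using that by (auto simp: fun_eq_iff)
    then have "card {i. p i = i} < CARD('n)" by (intro psubset_card_mono) auto
    then show ?thesis using dt[of p] by simp
  qed
  have t_id: "t id = (\<Prod>i\<in>UNIV. [:- (M $ i $ i), 1:])" by (simp add: t_def e_def)
  have deg_id: "degree (t id) = CARD('n)"
    unfolding t_id by (subst degree_prod_sum_eq) auto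
  have lc_id: "lead_coeff (t id) = 1" unfolding t_id lead_coeff_prod by simp
  have "coeff (charpoly M) (CARD('n)) = (\<Sum>p | p permutes (UNIV :: 'n set). if p = id then 1 else 0)"
    unfolding cp coeff_sum
    by (rule sum.cong) (use less lc_id deg_id in \<open>auto intro: coeff_eq_0\<close>)
  also have "\<dots> = 1" by (subst sum.delta) (auto intro: permutes_id)
  finally have c: "coeff (charpoly M) (CARD('n)) = 1" .
  have "degree (charpoly M) \<le> CARD('n)"
    unfolding cp
  proof (rule degree_sum_le)
    show "degree (t p) \<le> CARD('n)" for p
      using dt[of p] card_mono[of UNIV "{i. p i = i}"] by simp
  qed simp
  moreover have "degree (charpoly M) \<ge> CARD('n)" using c by (intro le_degree) simp
  ultimately show "degree (charpoly M) = CARD('n)" by simp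
  then show "lead_coeff (charpoly M) = 1" using c by simp
qed

lemma size_eigenvalue_mset:
  "size (eigenvalue_mset (M :: complex^'n^'n)) = CARD('n)"
  by (simp add: eigenvalue_mset_def size_proots_complex degree_charpoly)

lemma det_eq_prod_eigenvalues:
  "det (mat x - M) = (\<Prod>a\<in>#eigenvalue_mset M. x - a)"
proof -
  have "charpoly M = (\<Prod>a\<in>#eigenvalue_mset M. [:-a, 1:])"
    using complex_poly_decompose_multiset[of "charpoly M"]
    by (simp add: lead_coeff_charpoly eigenvalue_mset_def)
  then have "poly (charpoly M) x = poly (\<Prod>a\<in>#eigenvalue_mset M. [:-a, 1:]) x" by simp
  also have "\<dots> = (\<Prod>a\<in>#eigenvalue_mset M. x - a)"
    by (simp add: poly_prod_mset multiset.map_comp o_def)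
  finally show ?thesis by (simp add: poly_charpoly)
qed

lemma poly_ext: "(\<And>x. poly p x = poly q x) \<Longrightarrow> p = q" for p q :: "complex poly"
  by (simp add: poly_eq_poly_eq_iff[symmetric] fun_eq_iff)

text \<open>The factors are \<open>cnj a * x - 1\<close>; a zero \<open>a\<close> would make one of
  them constant and lose a root.\<close>

lemma proots_prod_linear_inverse:
  assumes "0 \<notin># N"
  shows "proots (\<Prod>a\<in>#N. [:-1, cnj a:]) = image_mset (\<lambda>a. inverse (cnj a)) N"
  using assms
proof (induction N)
  case (add a N)
  then have "a \<noteq> 0" "0 \<notin># N" by auto
  then have "[:-1, cnj a:] = smult (cnj a) [:- inverse (cnj a), 1:]" by simp
  then have "proots [:-1, cnj a:] = {#inverse (cnj a)#}"
    using \<open>a \<noteq> 0\<close> proots_linear_factor[of "- inverse (cnj a)"] by (metis proots_smult complex_cnj_zero_iff minus_minus)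
  moreover have "(\<Prod>a\<in>#N. [:-1, cnj a:]) \<noteq> 0" by (auto simp: prod_mset_zero_iff)
  ultimately have "proots ([:-1, cnj a:] * (\<Prod>a\<in>#N. [:-1, cnj a:]))
      = {#inverse (cnj a)#} + image_mset (\<lambda>a. inverse (cnj a)) N"
    by (subst proots_mult) (use \<open>a \<noteq> 0\<close> add.IH[OF \<open>0 \<notin># N\<close>] in simp_all)
  then show ?case by (simp del: mult_pCons_left)
qed simp

lemma proots_prod_linear: "proots (\<Prod>a\<in>#N. [:-a, 1:]) = N"
proof (induction N)
  case (add a N)
  have "(\<Prod>a\<in>#N. [:-a, 1:]) \<noteq> 0" by (auto simp: prod_mset_zero_iff)
  then have "proots ([:-a, 1:] * (\<Prod>a\<in>#N. [:-a, 1:])) = {#a#} + N"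
    by (subst proots_mult) (simp_all add: add.IH)
  then show ?case by (simp del: mult_pCons_left)
qed simp

text \<open>The values of the characteristic polynomial determine the multiplicities too; this
  identifies the limit of a sequence of eigenvalue tuples.\<close>

lemma eigenvalue_mset_eqI:
  assumes "\<And>x. det (mat x - M) = (\<Prod>a\<in>#N. x - a)"
  shows "eigenvalue_mset M = N"
proof -
  have "charpoly M = (\<Prod>a\<in>#N. [:-a, 1:])"
  proof (rule poly_ext)
    fix x show "poly (charpoly M) x = poly (\<Prod>a\<in>#N. [:-a, 1:]) x"
      using assms[of x] by (simp add: poly_charpoly poly_prod_mset multiset.map_comp o_def)
  qed
  then show ?thesis by (simp add: eigenvalue_mset_def proots_prod_linear)
qed

lemma mat_mult_vec: "mat c *v v = c *s v" for v :: "complex^'n"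
  by (simp add: vec_eq_iff matrix_vector_mult_def mat_def if_distrib if_distribR cong: if_cong)

lemma eigenvector_exists:
  assumes "a \<in># eigenvalue_mset M"
  obtains v where "v \<noteq> 0" "M *v v = a *s v"
proof -
  have "det (mat a - M) = 0"
    using assms by (auto simp: det_eq_prod_eigenvalues prod_mset_zero_iff)
  then have "\<not> invertible (mat a - M)" by (simp add: invertible_det_nz)
  then have "\<nexists>B. B ** (mat a - M) = mat 1" by (simp add: invertible_left_inverse)
  then obtain v where v: "(mat a - M) *v v = 0" "v \<noteq> 0"
    unfolding matrix_left_invertible_ker by blast
  then have "M *v v = a *s v" by (simp add: matrix_vector_mult_diff_rdistrib mat_mult_vec)
  then show ?thesis using that v(2) by blast
qed

lemma norm_vector_scalar_mult_complex: "norm (c *s v) = cmod c * norm v" for v :: "complex^'n"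
  by (simp add: norm_vec_def norm_mult L2_set_right_distrib)

lemma bounded_bilinear_matrix_vector_mult_complex:
  "bounded_bilinear ((*v) :: complex^'n^'m \<Rightarrow> complex^'n \<Rightarrow> complex^'m)"
  unfolding bilinear_conv_bounded_bilinear[symmetric] bilinear_def
  by (auto intro!: linearI simp: matrix_vector_mult_def vec_eq_iff algebra_simps sum.distrib
       scaleR_sum_right)

lemma bounded_bilinear_matrix_mult_complex:
  "bounded_bilinear ((**) :: complex^'n^'m \<Rightarrow> complex^'k^'n \<Rightarrow> complex^'k^'m)"
  unfolding bilinear_conv_bounded_bilinear[symmetric] bilinear_def
  by (auto intro!: linearI simp: matrix_matrix_mult_def vec_eq_iff algebra_simps sum.distrib
       scaleR_sum_right)

text \<open>One \<open>C\<close> serves all matrices of a given size, so a bounded set of matrices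
  has bounded eigenvalues.\<close>

lemma eigenvalue_norm_bound:
  "\<exists>C>0. \<forall>(M :: complex^'n^'n) a. a \<in># eigenvalue_mset M \<longrightarrow> cmod a \<le> C * norm M"
proof -
  obtain C where C: "C > 0" "\<And>(M :: complex^'n^'n) v. norm (M *v v) \<le> norm M * norm v * C"
    using bounded_bilinear.pos_bounded[OF bounded_bilinear_matrix_vector_mult_complex] by blast
  have "cmod a \<le> C * norm M" if "a \<in># eigenvalue_mset M" for M :: "complex^'n^'n" and a
  proof -
    obtain v where v: "v \<noteq> 0" "M *v v = a *s v" using eigenvector_exists[OF \<open>a \<in># _\<close>] by blast
    have "cmod a * norm v \<le> (C * norm M) * norm v"
      using C(2)[of M v] v(2) by (simp add: norm_vector_scalar_mult_complex mult_ac)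
    then show ?thesis using v(1) by simp
  qed
  then show ?thesis using C(1) by blast
qed

section \<open>Stability of the index under perturbation\<close>

definition spectral_index :: "complex^'n^'n \<Rightarrow> real" where
  "spectral_index M =
     (real (size (filter_mset (\<lambda>l. cmod l < 1) (eigenvalue_mset M))) -
      real (size (filter_mset (\<lambda>l. cmod l > 1) (eigenvalue_mset M)))) / 2"

definition hyperbolic :: "complex^'n^'n \<Rightarrow> bool" where
  "hyperbolic M \<longleftrightarrow> (\<forall>l\<in>#eigenvalue_mset M. cmod l \<noteq> 1)"

text \<open>Listing a multiset as a vector makes Bolzano-Weierstrass available for sequences of
  eigenvalue multisets. The enumeration is arbitrary: no continuous choice of eigenvalues is
  made.\<close>

lemma mset_eq_image_UNIV:
  assumes "size N = CARD('n::finite)"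
  obtains v :: "'a^'n" where "N = image_mset (\<lambda>i. v $ i) (mset_set UNIV)"
proof -
  obtain xs where xs: "N = mset xs" by (metis ex_mset)
  have "CARD('n) = card {0..<length xs}" using assms xs by simp
  from finite_same_card_bij[OF finite finite_atLeastLessThan this]
  obtain h where h: "bij_betw h (UNIV :: 'n set) {0..<length xs}" by blast
  define v :: "'a^'n" where "v = (\<chi> i. xs ! h i)"
  have "image_mset (\<lambda>i. v $ i) (mset_set UNIV) = image_mset (\<lambda>k. xs ! k) (image_mset h (mset_set UNIV))"
    by (simp add: v_def multiset.map_comp o_def)
  also have "image_mset h (mset_set UNIV) = mset_set {0..<length xs}"
    using h by (metis bij_betw_def image_mset_mset_set)
  also have "image_mset (\<lambda>k. xs ! k) (mset_set {0..<length xs}) = mset (map (\<lambda>k. xs ! k) [0..<length xs])"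
    by (simp only: mset_map mset_upt)
  also have "\<dots> = N" by (simp add: map_nth xs)
  finally show thesis using that by metis
qed

lemma det_tendsto:
  fixes A :: "nat \<Rightarrow> complex^'n^'n"
  assumes "A \<longlonglongrightarrow> B"
  shows "(\<lambda>n. det (A n)) \<longlonglongrightarrow> det B"
  unfolding det_def by (intro tendsto_intros tendsto_vec_nth assms)

text \<open>Compactness of the tuple of roots replaces a root-counting argument such as
  Rouche's theorem.\<close>

lemma spectral_index_locally_constant:
  fixes M0 :: "complex^'n^'n"
  assumes "hyperbolic M0"
  shows "\<exists>e>0. \<forall>M. dist M M0 < e \<longrightarrow> spectral_index M = spectral_index M0"
proof (rule ccontr)
  assume neg: "\<not> ?thesis"
  have "\<exists>M. dist M M0 < inverse (real (Suc n)) \<and> spectral_index M \<noteq> spectral_index M0" for n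
  proof -
    have "inverse (real (Suc n)) > 0" by simp
    with neg show ?thesis by blast
  qed
  then have "\<forall>n. \<exists>M. dist M M0 < inverse (real (Suc n)) \<and> spectral_index M \<noteq> spectral_index M0"
    by (rule allI)
  from choice[OF this] obtain M where
    MM: "\<forall>n. dist (M n) M0 < inverse (real (Suc n)) \<and> spectral_index (M n) \<noteq> spectral_index M0"
    by (rule exE)
  then have M: "dist (M n) M0 < inverse (real (Suc n))"
    and idx: "spectral_index (M n) \<noteq> spectral_index M0" for n by simp_all
  have "norm (dist (M n) M0) \<le> inverse (real (Suc n))" for n
    using M[of n] by (simp only: real_norm_def abs_of_nonneg[OF zero_le_dist] less_imp_le)
  then have "(\<lambda>n. dist (M n) M0) \<longlonglongrightarrow> 0"
    by (intro Lim_null_comparison[OF _ LIMSEQ_inverse_real_of_nat] always_eventually allI)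
  then have lim: "M \<longlonglongrightarrow> M0" by (rule tendsto_dist_iff[THEN iffD2])
  have "\<exists>v :: complex^'n. eigenvalue_mset (M n) = image_mset (\<lambda>i. v $ i) (mset_set UNIV)" for n
    by (rule mset_eq_image_UNIV[OF size_eigenvalue_mset, of "M n"]) (rule exI)
  then obtain v :: "nat \<Rightarrow> complex^'n"
    where v: "\<And>n. eigenvalue_mset (M n) = image_mset (\<lambda>i. v n $ i) (mset_set UNIV)" by metis
  obtain C where C: "C > 0" "\<And>(M :: complex^'n^'n) a. a \<in># eigenvalue_mset M \<Longrightarrow> cmod a \<le> C * norm M"
    using eigenvalue_norm_bound by blast
  obtain R where R: "\<And>n. norm (M n) \<le> R"
    using convergent_imp_bounded[OF lim] unfolding bounded_iff by blast
  have "norm (v n) \<le> CARD('n) * (C * R)" for n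
  proof -
    have "norm (v n) \<le> (\<Sum>i\<in>UNIV. norm (v n $ i))" 
      unfolding norm_vec_def by (rule L2_set_le_sum) simp
    also have "\<dots> \<le> (\<Sum>i\<in>(UNIV::'n set). C * R)"
    proof (rule sum_mono)
      fix i
      have "cmod (v n $ i) \<le> C * norm (M n)" by (rule C(2)) (simp add: v)
      also have "\<dots> \<le> C * R" using C(1) R by (intro mult_left_mono) auto
      finally show "cmod (v n $ i) \<le> C * R" .
    qed
    finally show ?thesis by simp
  qed
  then have "bounded (range v)" unfolding bounded_iff by blast
  then obtain b r where r: "strict_mono r" and b: "(v \<circ> r) \<longlonglongrightarrow> b"
    using bounded_imp_convergent_subsequence by blast
  have bi: "(\<lambda>n. v (r n) $ i) \<longlonglongrightarrow> b $ i" for i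
    using tendsto_vec_nth[OF b] by (simp add: o_def)
  have Mr: "(\<lambda>n. M (r n)) \<longlonglongrightarrow> M0" using LIMSEQ_subseq_LIMSEQ[OF lim r] by (simp add: o_def)
  \<comment> \<open>The characteristic polynomial depends continuously on the matrix and on the
    tuple of its roots. Comparing both limits at each \<open>x\<close> shows that the limit tuple
    lists the eigenvalues of \<open>M0\<close> with multiplicity.\<close>
  have ev0: "eigenvalue_mset M0 = image_mset (\<lambda>i. b $ i) (mset_set UNIV)"
  proof (rule eigenvalue_mset_eqI)
    fix x
    have "(\<lambda>n. det (mat x - M (r n))) \<longlonglongrightarrow> det (mat x - M0)"
      by (intro det_tendsto tendsto_intros Mr)
    moreover have "(\<lambda>n. det (mat x - M (r n))) \<longlonglongrightarrow> (\<Prod>i\<in>UNIV. x - b $ i)"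
      unfolding det_eq_prod_eigenvalues v
      by (simp add: multiset.map_comp o_def flip: prod_unfold_prod_mset) (intro tendsto_intros bi)
    ultimately show "det (mat x - M0) = (\<Prod>a\<in>#image_mset (\<lambda>i. b $ i) (mset_set UNIV). x - a)"
      using LIMSEQ_unique by (simp add: multiset.map_comp o_def flip: prod_unfold_prod_mset)
  qed
  have idx_image: "spectral_index N = (real (card {i. cmod (u $ i) < 1}) - real (card {i. cmod (u $ i) > 1})) / 2"
    if "eigenvalue_mset N = image_mset (\<lambda>i. u $ i) (mset_set UNIV)" for N :: "complex^'n^'n" and u :: "complex^'n"
    unfolding spectral_index_def that by (simp add: filter_mset_image_mset filter_mset_mset_set)
  have "\<forall>\<^sub>F n in sequentially. \<forall>i. (cmod (v (r n) $ i) < 1 \<longleftrightarrow> cmod (b $ i) < 1) \<and>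
      (cmod (v (r n) $ i) > 1 \<longleftrightarrow> cmod (b $ i) > 1)"
  proof (rule eventually_all_finite)
    fix i
    have t: "(\<lambda>n. cmod (v (r n) $ i)) \<longlonglongrightarrow> cmod (b $ i)" by (intro tendsto_norm bi)
    \<comment> \<open>Hyperbolicity enters here: a limit off the unit circle satisfies one of two
      open conditions, which then holds eventually along the sequence.\<close>
    have "cmod (b $ i) \<noteq> 1" using assms by (auto simp: hyperbolic_def ev0)
    then consider "cmod (b $ i) < 1" | "cmod (b $ i) > 1" by linarith
    then show "\<forall>\<^sub>F n in sequentially. (cmod (v (r n) $ i) < 1 \<longleftrightarrow> cmod (b $ i) < 1) \<and>
      (cmod (v (r n) $ i) > 1 \<longleftrightarrow> cmod (b $ i) > 1)"
    proof cases
      case 1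
      from order_tendstoD(2)[OF t 1] show ?thesis by eventually_elim (use 1 in auto)
    next
      case 2
      from order_tendstoD(1)[OF t 2] show ?thesis by eventually_elim (use 2 in auto)
    qed
  qed
  then obtain n where "\<forall>i. (cmod (v (r n) $ i) < 1 \<longleftrightarrow> cmod (b $ i) < 1) \<and>
      (cmod (v (r n) $ i) > 1 \<longleftrightarrow> cmod (b $ i) > 1)"
    using eventually_happens'[OF sequentially_bot] by blast
  then have "spectral_index (M (r n)) = spectral_index M0"
    unfolding idx_image[OF v] idx_image[OF ev0] by simp
  then show False using idx by blast
qed

text \<open>The parameter space is left general because three are used: the deformation interval, a
  segment of frequencies, and the component \<open>D\<close>.\<close>

lemma spectral_index_constant_on_connected:
  fixes M :: "'a::metric_space \<Rightarrow> complex^'n^'n"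
  assumes "connected A" "continuous_on A M" "\<And>x. x \<in> A \<Longrightarrow> hyperbolic (M x)" "x \<in> A" "y \<in> A"
  shows "spectral_index (M x) = spectral_index (M y)"
proof -
  have "(\<lambda>x. spectral_index (M x)) constant_on A"
  proof (rule locally_constant_imp_constant[OF assms(1)])
    fix a assume a: "a \<in> A"
    obtain e where e: "e > 0" "\<And>N. dist N (M a) < e \<Longrightarrow> spectral_index N = spectral_index (M a)"
      using spectral_index_locally_constant[OF assms(3)[OF a]] by blast
    have "openin (top_of_set A) (A \<inter> M -` ball (M a) e)"
      using assms(2) by (rule continuous_openin_preimage_gen) simp
    moreover have "a \<in> A \<inter> M -` ball (M a) e" using a e(1) by simp
    moreover have "\<forall>x\<in>A \<inter> M -` ball (M a) e. spectral_index (M x) = spectral_index (M a)"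
      using e(2) by (auto simp: dist_commute)
    ultimately show "\<exists>T. openin (top_of_set A) T \<and> a \<in> T \<and>
        (\<forall>x\<in>T. spectral_index (M x) = spectral_index (M a))" by blast
  qed
  then show ?thesis using assms(4,5) unfolding constant_on_def by metis
qed

section \<open>Matrices preserving a sesquilinear form\<close>

lemma conj_transpose_mult: "conj_transpose (A ** B) = conj_transpose B ** conj_transpose A"
  by (simp add: conj_transpose_def matrix_matrix_mult_def vec_eq_iff mult.commute)

lemma det_conj_transpose: "det (conj_transpose A) = cnj (det A)"
proof -
  have "conj_transpose A = transpose (\<chi> i j. cnj (A $ i $ j))"
    by (simp add: conj_transpose_def transpose_def vec_eq_iff)
  then have "det (conj_transpose A) = det (\<chi> i j. cnj (A $ i $ j))" by simp
  also have "\<dots> = cnj (det A)" by (simp add: det_def cnj_sum cnj_prod)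
  finally show ?thesis .
qed

lemma det_mat: "det (mat c :: 'a::comm_ring_1^'n^'n) = c ^ CARD('n)"
  by (subst det_diagonal) (auto simp: mat_def)

lemma cnj_prod_mset: "cnj (\<Prod>\<^sub># N) = (\<Prod>a\<in>#N. cnj a)"
  by (induction N) simp_all

lemma mat_mult_nth: "(mat c ** A) $ i $ j = c * A $ i $ j" for A :: "complex^'n^'n"
  by (simp add: matrix_matrix_mult_def mat_def if_distrib if_distribR cong: if_cong)

lemma mat_commute: "A ** mat c = mat c ** A" for A :: "complex^'n^'n"
  unfolding vec_eq_iff mat_mult_nth
  by (simp add: matrix_matrix_mult_def mat_def if_distrib if_distribR mult.commute cong: if_cong)

text \<open>Invariance of a nondegenerate sesquilinear form makes \<open>M\<close> similar to the inverse of
  its adjoint, so the spectrum is symmetric under \<open>a \<mapsto> 1 / cnj a\<close>.\<close>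

lemma spectral_index_eq_0:
  fixes M :: "complex^'n^'n"
  assumes form: "conj_transpose M ** K ** M = K" and K: "det K \<noteq> 0"
  shows "spectral_index M = 0"
proof -
  let ?N = "eigenvalue_mset M" and ?M' = "conj_transpose M"
  have "det ?M' * det K * det M = det K" using form by (metis det_mul)
  then have nz: "det ?M' \<noteq> 0" "det M \<noteq> 0" using K by auto
  have a0: "0 \<notin># ?N"
  proof
    assume "0 \<in># ?N"
    then obtain v where v: "v \<noteq> 0" "M *v v = 0 *s v" by (rule eigenvector_exists)
    have "invertible M" using nz(2) by (simp add: invertible_det_nz)
    then have "\<exists>B. B ** M = mat 1" by (simp add: invertible_left_inverse)
    then show False using v unfolding matrix_left_invertible_ker by simp
  qed
  \<comment> \<open>Invariance turns \<open>?M' ** K ** (mat x - M)\<close> into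
    \<open>(mat x ** ?M' - mat 1) ** K\<close>. Determinants cancel \<open>det K\<close> and relate
    the characteristic polynomial to the reversed one of the adjoint, multiplicities
    included.\<close>
  have key: "det ?M' * (\<Prod>a\<in>#?N. x - a) = (\<Prod>a\<in>#?N. x * cnj a - 1)" if "x \<noteq> 0" for x
  proof -
    have "?M' ** K ** (mat x - M) = (mat x ** ?M' - mat 1) ** K"
    proof -
      have "?M' ** K ** mat x = mat x ** ?M' ** K"
        by (simp only: mat_commute matrix_mul_assoc)
      then show ?thesis
        by (simp add: bounded_bilinear.diff_left[OF bounded_bilinear_matrix_mult_complex]
            bounded_bilinear.diff_right[OF bounded_bilinear_matrix_mult_complex] form)
    qed
    then have "det (?M' ** K ** (mat x - M)) = det ((mat x ** ?M' - mat 1) ** K)" by simp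
    then have "det ?M' * det (mat x - M) = det (mat x ** ?M' - mat 1)"
      using K by (simp add: det_mul)
    also have "mat x ** ?M' - mat 1 = mat (-x) ** (mat (inverse x) - ?M')"
      using that by (simp add: vec_eq_iff mat_mult_nth) (simp add: mat_def algebra_simps)
    also have "det \<dots> = (-x) ^ CARD('n) * det (mat (inverse x) - ?M')"
      by (simp add: det_mul det_mat)
    also have "mat (inverse x) - ?M' = conj_transpose (mat (cnj (inverse x)) - M)"
      by (simp add: conj_transpose_def mat_def vec_eq_iff)
    also have "det \<dots> = cnj (\<Prod>a\<in>#?N. cnj (inverse x) - a)"
      by (simp only: det_conj_transpose det_eq_prod_eigenvalues)
    also have "\<dots> = (\<Prod>a\<in>#?N. inverse x - cnj a)"
      by (simp add: cnj_prod_mset multiset.map_comp o_def)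
    also have "(-x) ^ CARD('n) * \<dots> = (\<Prod>a\<in>#?N. (-x) * (inverse x - cnj a))"
      by (simp only: prod_mset.distrib prod_mset_constant size_eigenvalue_mset)
    also have "\<dots> = (\<Prod>a\<in>#?N. x * cnj a - 1)"
      using that by (intro arg_cong[where f = prod_mset] image_mset_cong) (simp add: algebra_simps)
    finally show ?thesis by (simp add: det_eq_prod_eigenvalues)
  qed
  define p where "p = smult (det ?M') (\<Prod>a\<in>#?N. [:-a, 1:])"
  define q where "q = (\<Prod>a\<in>#?N. [:-1, cnj a:])"
  have "p * [:0, 1:] = q * [:0, 1:]"
  proof (rule poly_ext)
    fix x
    show "poly (p * [:0, 1:]) x = poly (q * [:0, 1:]) x"
      using key[of x] by (cases "x = 0") (simp_all add: p_def q_def poly_prod_mset multiset.map_comp o_def)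
  qed
  then have "p = q" by simp
  have "proots q = image_mset (\<lambda>a. inverse (cnj a)) ?N"
    unfolding q_def by (rule proots_prod_linear_inverse[OF a0])
  moreover have "proots p = ?N" using nz(1) by (simp add: p_def proots_prod_linear)
  ultimately have sym: "?N = image_mset (\<lambda>a. inverse (cnj a)) ?N" using \<open>p = q\<close> by simp
  have "size (filter_mset (\<lambda>l. cmod l < 1) ?N)
      = size (filter_mset (\<lambda>l. cmod l < 1) (image_mset (\<lambda>a. inverse (cnj a)) ?N))"
    using sym by simp
  also have "\<dots> = size (filter_mset (\<lambda>a. cmod (inverse (cnj a)) < 1) ?N)"
    by (simp add: filter_mset_image_mset)
  also have "filter_mset (\<lambda>a. cmod (inverse (cnj a)) < 1) ?N = filter_mset (\<lambda>a. cmod a > 1) ?N"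
  proof (rule filter_mset_cong0)
    fix a assume "a \<in># ?N"
    then have "cmod a > 0" using a0 by auto
    then show "(cmod (inverse (cnj a)) < 1) = (1 < cmod a)"
      unfolding norm_inverse complex_mod_cnj by (auto simp: inverse_less_1_iff)
  qed
  finally show ?thesis by (simp add: spectral_index_def)
qed

section \<open>The monodromy matrix\<close>

lemma sum_UNIV_sum_type:
  fixes f :: "'a::finite + 'b::finite \<Rightarrow> 'c::comm_monoid_add"
  shows "(\<Sum>i\<in>UNIV. f i) = (\<Sum>a\<in>UNIV. f (Inl a)) + (\<Sum>b\<in>UNIV. f (Inr b))"
  by (subst UNIV_Plus_UNIV[symmetric], subst sum.Plus) (auto simp: o_def)

lemma block_mat_nth [simp]:
  "block_mat A B C D $ Inl a $ Inl b = A $ a $ b"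
  "block_mat A B C D $ Inl a $ Inr b' = B $ a $ b'"
  "block_mat A B C D $ Inr a' $ Inl b = C $ a' $ b"
  "block_mat A B C D $ Inr a' $ Inr b' = D $ a' $ b'"
  by (simp_all add: block_mat_def)

lemma block_mat_mult:
  "block_mat A B C D ** block_mat A' B' C' D' =
   block_mat (A ** A' + B ** C') (A ** B' + B ** D') (C ** A' + D ** C') (C ** B' + D ** D')"
  by (simp add: vec_eq_iff split_sum_all matrix_matrix_mult_def sum_UNIV_sum_type)

lemma block_mat_add:
  "block_mat A B C D + block_mat A' B' C' D' = block_mat (A + A') (B + B') (C + C') (D + D')"
  by (simp add: vec_eq_iff split_sum_all)

lemma block_mat_uminus: "- block_mat A B C D = block_mat (- A) (- B) (- C) (- D)"
  by (simp add: vec_eq_iff split_sum_all)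

lemma block_mat_scalar: "block_mat (mat c) 0 0 (mat c) = mat c"
  by (simp add: vec_eq_iff split_sum_all mat_def)

lemma conj_transpose_block_mat:
  "conj_transpose (block_mat A B C D) =
   block_mat (conj_transpose A) (conj_transpose C) (conj_transpose B) (conj_transpose D)"
  by (simp add: vec_eq_iff split_sum_all conj_transpose_def)

lemma Q2_square: "Q2 ** Q2 = mat (-1)"
  by (simp add: vec_eq_iff forall_2 Q2_def matrix_matrix_mult_def sum_2 mat_def)

lemma mat_uminus: "mat (- c) = - mat c" for c :: "'a::ring_1"
  by (simp add: vec_eq_iff mat_def)

lemma matrix_mult_minus:
  fixes A :: "complex^'n^'m" and B :: "complex^'k^'n"
  shows "A ** (- B) = - (A ** B)" "(- A) ** B = - (A ** B)"
  by (simp_all add: matrix_matrix_mult_def vec_eq_iff sum_negf)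

lemma conj_transpose_Q2: "conj_transpose Q2 = - Q2"
  by (simp add: vec_eq_iff forall_2 Q2_def conj_transpose_def)

lemma matrix_inv_Q4: "matrix_inv Q4 = - Q4"
proof -
  have "Q4 ** Q4 = mat (-1)"
    by (simp add: Q4_def block_mat_mult Q2_square block_mat_scalar)
  then have Q: "Q4 ** (- Q4) = mat 1 \<and> (- Q4) ** Q4 = mat 1"
    by (simp add: matrix_mult_minus mat_uminus)
  then have "matrix_inv Q4 ** Q4 = mat 1"
    unfolding matrix_inv_def by (rule someI2[where Q = "\<lambda>A. A ** Q4 = mat 1"]) simp
  then have "matrix_inv Q4 ** (Q4 ** (- Q4)) = - Q4"
    by (simp only: matrix_mul_assoc matrix_mul_lid)
  then show ?thesis using Q by simp
qed

text \<open>The coefficient matrix as a function of the frequency and of the values of the two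
  material matrices. In this form it is bilinear over the reals, so boundedness, continuity and
  difference estimates follow from the rules for products.\<close>

definition medium_field :: "complex \<Rightarrow> cmat2 \<times> cmat2 \<Rightarrow> cmat4" where
  "medium_field \<omega> p = mat \<omega> ** matrix_inv Q4 ** (mat \<i> ** block_mat 0 (snd p) (- fst p) 0)"

lemma coef_eq_medium_field: "coef eps mu \<omega> z = medium_field \<omega> (eps z, mu z)"
  by (simp add: coef_def A_mat_def medium_field_def)

lemma bounded_bilinear_medium_field: "bounded_bilinear medium_field"
proof -
  interpret mm: bounded_bilinear "(**) :: cmat4 \<Rightarrow> cmat4 \<Rightarrow> cmat4"
    by (rule bounded_bilinear_matrix_mult_complex)
  have "linear (\<lambda>\<omega>. mat \<omega> ** matrix_inv Q4 :: cmat4)"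
    by (rule linearI) (simp_all add: vec_eq_iff mat_mult_nth algebra_simps)
  moreover have "linear (\<lambda>p. mat \<i> ** block_mat 0 (snd p) (- fst p) 0)"
    by (rule linearI) (simp_all add: vec_eq_iff mat_mult_nth split_sum_all algebra_simps)
  ultimately show ?thesis
    unfolding medium_field_def linear_conv_bounded_linear by (rule mm.comp)
qed

lemma admissible_pair_bounded:
  assumes "admissible eps" "admissible mu"
  shows "\<exists>B\<ge>0. \<forall>z. norm (eps z, mu z) \<le> B"
proof -
  obtain A B where "\<And>z. norm (eps z) \<le> A" "\<And>z. norm (mu z) \<le> B"
    using assms unfolding admissible_def bounded_iff by (metis rangeI)
  then have "norm (eps z, mu z) \<le> A + B" for z
    using norm_Pair_le[of "eps z" "mu z"] add_mono order_trans by blast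
  then show ?thesis by (meson norm_ge_zero order_trans)
qed

lemma admissible_pair_isCont:
  assumes "admissible eps" "admissible mu"
  shows "\<exists>S. locally_finite_set S \<and> (\<forall>z. z \<notin> S \<longrightarrow> isCont (\<lambda>z. (eps z, mu z)) z)"
proof -
  obtain S T where "locally_finite_set S" "\<forall>z. z \<notin> S \<longrightarrow> isCont eps z"
      "locally_finite_set T" "\<forall>z. z \<notin> T \<longrightarrow> isCont mu z"
    using assms unfolding admissible_def piecewise_continuous_def by blast
  then show ?thesis
    by (intro exI[of _ "S \<union> T"]) (simp add: locally_finite_set_Un isCont_Pair)
qed

lemma coef_bounded:
  assumes "admissible eps" "admissible mu"
  shows "\<exists>B>0. \<forall>z. norm (coef eps mu \<omega> z) \<le> B"
proof -
  obtain B where B: "B \<ge> 0" "\<And>z. norm (eps z, mu z) \<le> B"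
    using admissible_pair_bounded[OF assms] by blast
  obtain C where C: "C > 0" "\<And>\<omega> p. norm (medium_field \<omega> p) \<le> norm \<omega> * norm p * C"
    using bounded_bilinear.pos_bounded[OF bounded_bilinear_medium_field] by blast
  \<comment> \<open>The summand 1 keeps the bound strictly positive even for
    \<open>\<omega> = 0\<close>, as the existence theorem requires.\<close>
  have "norm (coef eps mu \<omega> z) \<le> norm \<omega> * B * C + 1" for z
  proof -
    have "norm (coef eps mu \<omega> z) \<le> norm \<omega> * norm (eps z, mu z) * C"
      unfolding coef_eq_medium_field by (rule C(2))
    also have "\<dots> \<le> norm \<omega> * B * C"
      using B(2) C(1) by (intro mult_right_mono mult_left_mono) auto
    finally show ?thesis by simp
  qed
  moreover have "norm \<omega> * B * C + 1 > 0"
    using B(1) C(1) by (intro add_nonneg_pos mult_nonneg_nonneg) auto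
  ultimately show ?thesis by blast
qed

lemma coef_isCont:
  assumes "admissible eps" "admissible mu"
  shows "\<exists>S. locally_finite_set S \<and> (\<forall>z. z \<notin> S \<longrightarrow> isCont (coef eps mu \<omega>) z)"
proof -
  interpret f: bounded_bilinear medium_field by (rule bounded_bilinear_medium_field)
  obtain S where "locally_finite_set S" "\<forall>z. z \<notin> S \<longrightarrow> isCont (\<lambda>z. (eps z, mu z)) z"
    using admissible_pair_isCont[OF assms] by blast
  moreover have "coef eps mu \<omega> = (\<lambda>z. medium_field \<omega> (eps z, mu z))"
    by (simp add: fun_eq_iff coef_eq_medium_field)
  ultimately show ?thesis by (auto intro!: f.isCont)
qed

text \<open>The product is abstract so that one proof covers matrix solutions, for the transfer
  matrix, and vector solutions, for Bloch waves.\<close>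

lemma linear_solution_unique:
  fixes prod :: "'m::real_normed_vector \<Rightarrow> 'a::real_inner \<Rightarrow> 'a"
  assumes prod: "bounded_bilinear prod" and A: "\<And>z. norm (A z) \<le> B"
    and x: "solves_ode x (\<lambda>z v. prod (A z) v)" and y: "solves_ode y (\<lambda>z v. prod (A z) v)"
    and init: "x a = y a"
  shows "x z = y z"
proof -
  interpret p: bounded_bilinear prod by (rule prod)
  obtain C where C: "C > 0" "\<And>a b. norm (prod a b) \<le> norm a * norm b * C"
    using p.pos_bounded by blast
  obtain S where S: "locally_finite_set S"
      "\<And>z. z \<notin> S \<Longrightarrow> (x has_vector_derivative prod (A z) (x z)) (at z)" "continuous_on UNIV x"
    using x unfolding solves_ode_def by blast
  obtain T where T: "locally_finite_set T"
      "\<And>z. z \<notin> T \<Longrightarrow> (y has_vector_derivative prod (A z) (y z)) (at z)" "continuous_on UNIV y"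
    using y unfolding solves_ode_def by blast
  have "x z - y z = 0"
  proof (rule solves_ode_unique_zero[where y = "\<lambda>z. x z - y z" and a = a])
    show "locally_finite_set (S \<union> T)" using S T by (simp add: locally_finite_set_Un)
    show "continuous_on UNIV (\<lambda>z. x z - y z)" using S T by (intro continuous_intros)
    show "x a - y a = 0" using init by simp
    fix z assume "z \<notin> S \<union> T"
    then show "((\<lambda>z. x z - y z) has_vector_derivative prod (A z) (x z - y z)) (at z)"
      unfolding p.diff_right by (intro has_vector_derivative_diff S T) auto
    have "norm (prod (A z) (x z - y z)) \<le> norm (A z) * norm (x z - y z) * C" by (rule C(2))
    also have "\<dots> \<le> B * norm (x z - y z) * C"
      using A C(1) by (intro mult_right_mono) auto
    finally show "norm (prod (A z) (x z - y z)) \<le> (B * C) * norm (x z - y z)"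
      by (simp add: mult_ac)
  qed
  then show ?thesis by simp
qed

context
  fixes eps mu :: medium and \<omega> :: complex
  assumes adm: "admissible eps" "admissible mu"
begin

text \<open>This gives meaning to the definite description in \<open>transfer_matrix\<close>, at the
  base point that the monodromy matrix uses.\<close>

lemma transfer_matrix_ex1:
  "\<exists>!T. solves_ode T (\<lambda>z X. coef eps mu \<omega> z ** X) \<and> T 0 = mat 1"
proof -
  obtain B where B: "B > 0" "\<And>z. norm (coef eps mu \<omega> z) \<le> B"
    using coef_bounded[OF adm] by blast
  obtain S where S: "locally_finite_set S" "\<And>z. z \<notin> S \<Longrightarrow> isCont (coef eps mu \<omega>) z"
    using coef_isCont[OF adm] by blast
  interpret mm: bounded_bilinear "(**) :: cmat4 \<Rightarrow> cmat4 \<Rightarrow> cmat4"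
    by (rule bounded_bilinear_matrix_mult_complex)
  obtain C where C: "C > 0" "\<And>(a::cmat4) (b::cmat4). norm (a ** b) \<le> norm a * norm b * C"
    using mm.pos_bounded by blast
  have "\<exists>T. solves_ode T (\<lambda>z X. coef eps mu \<omega> z ** X) \<and> T 0 = mat 1"
  proof (rule linear_ode_exists[OF S(1)])
    show "linear (\<lambda>X::cmat4. coef eps mu \<omega> z ** X)" for z
      by (rule bounded_linear.linear[OF mm.bounded_linear_right])
    show "B * C > 0" using B C by simp
    show "norm (coef eps mu \<omega> z ** X) \<le> B * C * norm X" for z and X :: cmat4
    proof -
      have "norm (coef eps mu \<omega> z ** X) \<le> norm (coef eps mu \<omega> z) * norm X * C" by (rule C(2))
      also have "\<dots> \<le> B * norm X * C" using B C(1) by (intro mult_right_mono) auto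
      finally show ?thesis by (simp add: mult_ac)
    qed
    show "isCont (\<lambda>z. coef eps mu \<omega> z ** X) z" if "z \<notin> S" for z and X :: cmat4
      by (intro mm.isCont S that continuous_const)
  qed
  moreover have "T = T'" if "solves_ode T (\<lambda>z X. coef eps mu \<omega> z ** X) \<and> T 0 = mat 1"
      "solves_ode T' (\<lambda>z X. coef eps mu \<omega> z ** X) \<and> T' 0 = mat 1" for T T'
  proof
    show "T z = T' z" for z
      by (rule linear_solution_unique[OF bounded_bilinear_matrix_mult_complex B(2)
          that(1)[THEN conjunct1] that(2)[THEN conjunct1], where a = 0]) (simp add: that)
  qed
  ultimately show ?thesis by blast
qed

lemma
  shows transfer_matrix_solves:
      "solves_ode (\<lambda>z. transfer_matrix eps mu \<omega> z 0) (\<lambda>z X. coef eps mu \<omega> z ** X)"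
    and transfer_matrix_0: "transfer_matrix eps mu \<omega> 0 0 = mat 1"
proof -
  have *: "(\<lambda>z. transfer_matrix eps mu \<omega> z 0) =
      (THE T. solves_ode T (\<lambda>z X. coef eps mu \<omega> z ** X) \<and> T 0 = mat 1)"
    by (simp add: transfer_matrix_def fun_eq_iff)
  show "solves_ode (\<lambda>z. transfer_matrix eps mu \<omega> z 0) (\<lambda>z X. coef eps mu \<omega> z ** X)"
    unfolding * using theI'[OF transfer_matrix_ex1] by blast
  show "transfer_matrix eps mu \<omega> 0 0 = mat 1"
    using theI'[OF transfer_matrix_ex1] by (simp add: transfer_matrix_def)
qed

end

text \<open>The difference of the two transfer matrices starts at 0 and solves the perturbed
  equation with forcing \<open>(?c' z - ?c z) ** T z\<close>, so Gronwall's inequality applies. The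
  constant depends on the unperturbed system alone, because \<open>\<eta> \<le> 1\<close> bounds the
  perturbed coefficients off the jumps by \<open>B + 1\<close>.\<close>

lemma monodromy_lipschitz:
  assumes adm: "admissible eps" "admissible mu"
  shows "\<exists>C\<ge>0. \<forall>eps' mu' \<omega>' \<eta> S. admissible eps' \<longrightarrow> admissible mu' \<longrightarrow> 0 \<le> \<eta> \<longrightarrow> \<eta> \<le> 1 \<longrightarrow>
     locally_finite_set S \<longrightarrow>
     (\<forall>z. z \<notin> S \<longrightarrow> norm (coef eps' mu' \<omega>' z - coef eps mu \<omega> z) \<le> \<eta>) \<longrightarrow>
     norm (monodromy eps' mu' \<omega>' - monodromy eps mu \<omega>) \<le> C * \<eta>"
proof -
  define T where "T z = transfer_matrix eps mu \<omega> z 0" for z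
  obtain B where B: "B > 0" "\<And>z. norm (coef eps mu \<omega> z) \<le> B"
    using coef_bounded[OF adm] by blast
  interpret mm: bounded_bilinear "(**) :: cmat4 \<Rightarrow> cmat4 \<Rightarrow> cmat4"
    by (rule bounded_bilinear_matrix_mult_complex)
  obtain C where C: "C > 0" "\<And>(a::cmat4) (b::cmat4). norm (a ** b) \<le> norm a * norm b * C"
    using mm.pos_bounded by blast
  obtain S1 where S1: "locally_finite_set S1" "continuous_on UNIV T"
      "\<And>z. z \<notin> S1 \<Longrightarrow> (T has_vector_derivative coef eps mu \<omega> z ** T z) (at z)"
    using transfer_matrix_solves[OF adm] unfolding solves_ode_def T_def by blast
  have "bounded (T ` {0..1})"
    by (intro compact_imp_bounded compact_continuous_image continuous_on_subset[OF S1(2)]) auto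
  then obtain R where "R > 0" and R: "\<And>z. z \<in> {0..1} \<Longrightarrow> norm (T z) \<le> R"
    unfolding bounded_pos by blast
  define L where "L = C * R * exp ((2 * ((B + 1) * C) + 1) * (1 - 0) / 2)"
  have "norm (monodromy eps' mu' \<omega>' - monodromy eps mu \<omega>) \<le> L * \<eta>"
    if adm': "admissible eps'" "admissible mu'" and \<eta>: "0 \<le> \<eta>" "\<eta> \<le> 1" and S: "locally_finite_set S"
      and diff: "\<And>z. z \<notin> S \<Longrightarrow> norm (coef eps' mu' \<omega>' z - coef eps mu \<omega> z) \<le> \<eta>"
    for eps' mu' \<omega>' \<eta> S
  proof -
    define T' where "T' z = transfer_matrix eps' mu' \<omega>' z 0" for z
    obtain S2 where S2: "locally_finite_set S2" "continuous_on UNIV T'"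
      "\<And>z. z \<notin> S2 \<Longrightarrow> (T' has_vector_derivative coef eps' mu' \<omega>' z ** T' z) (at z)"
      using transfer_matrix_solves[OF adm'] unfolding solves_ode_def T'_def by blast
    let ?c = "coef eps mu \<omega>" and ?c' = "coef eps' mu' \<omega>'"
    have "norm (T' 1 - T 1) \<le> (\<eta> * R * C) * exp ((2 * ((B + 1) * C) + 1) * (1 - 0) / 2)"
    proof (rule gronwall)
      show "finite ((S \<union> S1 \<union> S2) \<inter> {0..1})"
        using locally_finite_set_Un[OF locally_finite_set_Un[OF S S1(1)] S2(1)]
        by (simp only: locally_finite_set_def)
      show "continuous_on {0..1} (\<lambda>z. T' z - T z)"
        by (intro continuous_intros continuous_on_subset[OF S1(2)] continuous_on_subset[OF S2(2)]) auto
      show "T' 0 - T 0 = 0" by (simp add: T_def T'_def transfer_matrix_0 adm adm')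
      show "(B + 1) * C \<ge> 0" "\<eta> * R * C \<ge> 0" using B C \<eta> \<open>R > 0\<close> by auto
      fix z :: real assume "z \<in> {0<..<1} - (S \<union> S1 \<union> S2) \<inter> {0..1}"
      then have z: "z \<in> {0..1}" "z \<notin> S" "z \<notin> S1" "z \<notin> S2" by auto
      show "((\<lambda>z. T' z - T z) has_vector_derivative (?c' z ** (T' z - T z) + (?c' z - ?c z) ** T z)) (at z)"
        using has_vector_derivative_diff[OF S2(3)[OF z(4)] S1(3)[OF z(3)]]
        by (simp add: mm.diff_left mm.diff_right)
      have "norm (?c' z) \<le> B + 1"
        using norm_triangle_ineq[of "?c' z - ?c z" "?c z"] diff[OF z(2)] B(2)[of z] \<eta> by simp
      then have "norm (?c' z) * norm (T' z - T z) * C \<le> (B + 1) * norm (T' z - T z) * C"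
        using C(1) by (intro mult_right_mono) auto
      then have 1: "norm (?c' z ** (T' z - T z)) \<le> (B + 1) * norm (T' z - T z) * C"
        by (rule order_trans[OF C(2)])
      have "norm (?c' z - ?c z) * norm (T z) * C \<le> \<eta> * R * C"
        using C(1) \<eta> R[OF z(1)] diff[OF z(2)] by (intro mult_right_mono mult_mono) auto
      then have 2: "norm ((?c' z - ?c z) ** T z) \<le> \<eta> * R * C"
        by (rule order_trans[OF C(2)])
      show "norm (?c' z ** (T' z - T z) + (?c' z - ?c z) ** T z)
          \<le> (B + 1) * C * norm (T' z - T z) + \<eta> * R * C"
        using norm_triangle_le[OF add_mono[OF 1 2]] by (simp add: mult_ac)
    qed simp
    then show ?thesis by (simp add: L_def T_def T'_def monodromy_def mult_ac)
  qed
  moreover have "L \<ge> 0" using C \<open>R > 0\<close> by (simp add: L_def)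
  ultimately show ?thesis by blast
qed

section \<open>Continuous dependence on the medium\<close>

lemma AE_lborel_exists_in_interval:
  fixes a b :: real
  assumes "AE x in lborel. P x" "a < b"
  shows "\<exists>x\<in>{a..b}. P x"
proof (rule ccontr)
  assume neg: "\<not> ?thesis"
  obtain N where N: "{x\<in>space lborel. \<not> P x} \<subseteq> N" "N \<in> null_sets lborel"
    using assms(1) by (auto elim: AE_E3 simp: eventually_ae_filter)
  have "{a..b} \<subseteq> N" using N(1) neg by auto
  then have "{a..b} \<in> null_sets lborel" using N(2) by (rule null_sets_subset[OF _ _, rotated 2]) auto
  then show False using assms(2) by (simp add: null_sets_def)
qed

text \<open>A violation at a common point of continuity would persist on a punctured neighbourhood,
  which contains intervals of positive length and so contradicts the almost everywhere
  bound.\<close>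

lemma esssup_bound_off_jumps:
  fixes f f0 :: medium
  assumes f: "admissible f" and f0: "admissible f0"
    and less: "esssup lborel (\<lambda>z. ereal (norm (f z - f0 z))) < ereal \<delta>"
  shows "\<exists>S. locally_finite_set S \<and> (\<forall>z. z \<notin> S \<longrightarrow> norm (f z - f0 z) \<le> \<delta>)"
proof -
  obtain S where S: "locally_finite_set S" "\<forall>z. z \<notin> S \<longrightarrow> isCont (\<lambda>z. (f z, f0 z)) z"
    using admissible_pair_isCont[OF f f0] by blast
  have ae: "AE z in lborel. norm (f z - f0 z) < \<delta>"
    using esssup_AE[of "\<lambda>z. ereal (norm (f z - f0 z))" lborel]
  proof eventually_elim
    case (elim z)
    then have "ereal (norm (f z - f0 z)) < ereal \<delta>" using less by (rule le_less_trans)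
    then show ?case by simp
  qed
  have "norm (f z - f0 z) \<le> \<delta>" if "z \<notin> S" for z
  proof (rule ccontr)
    assume *: "\<not> ?thesis"
    have "isCont (\<lambda>z. (f z, f0 z)) z" using S(2) that by blast
    from isCont_fst[OF this] isCont_snd[OF this]
    have "isCont (\<lambda>z. norm (f z - f0 z)) z" by (intro continuous_intros) simp_all
    then have "\<forall>\<^sub>F w in at z. norm (f w - f0 w) > \<delta>"
      using * by (intro order_tendstoD) (auto simp: isCont_def)
    then obtain d where d: "d > 0" "\<And>w. w \<noteq> z \<Longrightarrow> dist w z < d \<Longrightarrow> norm (f w - f0 w) > \<delta>"
      unfolding eventually_at by blast
    \<comment> \<open>The neighbourhood is punctured, so the interval avoids \<open>z\<close>; both
      of its end points are within distance \<open>d\<close>.\<close>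
    obtain w where w: "w \<in> {z + d/3..z + d/2}" "norm (f w - f0 w) < \<delta>"
      using AE_lborel_exists_in_interval[OF ae, of "z + d/3" "z + d/2"] d(1) by auto
    have "w \<noteq> z" "dist w z < d" using w(1) d(1) by (auto simp: dist_real_def)
    then show False using d(2)[of w] w(2) by simp
  qed
  then show ?thesis using S(1) by blast
qed

text \<open>The filter is arbitrary so as to cover a varying frequency in a fixed medium as well as
  a varying point of the deformation.\<close>

lemma monodromy_tendsto:
  assumes adm0: "admissible eps" "admissible mu"
    and adm: "\<forall>\<^sub>F s in F. admissible (e s) \<and> admissible (m s)"
    and e: "((\<lambda>s. esssup lborel (\<lambda>z. ereal (norm (e s z - eps z)))) \<longlongrightarrow> 0) F"
    and m: "((\<lambda>s. esssup lborel (\<lambda>z. ereal (norm (m s z - mu z)))) \<longlongrightarrow> 0) F"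
    and w: "(w \<longlongrightarrow> \<omega>) F"
  shows "((\<lambda>s. monodromy (e s) (m s) (w s)) \<longlongrightarrow> monodromy eps mu \<omega>) F"
proof (rule tendstoI)
  fix r :: real assume r: "r > 0"
  interpret f: bounded_bilinear medium_field by (rule bounded_bilinear_medium_field)
  obtain L where L: "L \<ge> 0" "\<And>eps' mu' \<omega>' \<eta> S. admissible eps' \<Longrightarrow> admissible mu' \<Longrightarrow> 0 \<le> \<eta> \<Longrightarrow>
     \<eta> \<le> 1 \<Longrightarrow> locally_finite_set S \<Longrightarrow>
     (\<And>z. z \<notin> S \<Longrightarrow> norm (coef eps' mu' \<omega>' z - coef eps mu \<omega> z) \<le> \<eta>) \<Longrightarrow>
     norm (monodromy eps' mu' \<omega>' - monodromy eps mu \<omega>) \<le> L * \<eta>"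
    using monodromy_lipschitz[OF adm0, of \<omega>] by blast
  obtain C where C: "C > 0" "\<And>\<omega> p. norm (medium_field \<omega> p) \<le> norm \<omega> * norm p * C"
    using f.pos_bounded by blast
  obtain B where B: "B \<ge> 0" "\<And>z. norm (eps z, mu z) \<le> B"
    using admissible_pair_bounded[OF adm0] by blast
  \<comment> \<open>The tolerances are chosen backwards. \<open>\<eta>\<close> ensures
    \<open>L * \<eta> < r\<close>, with denominator \<open>L + 1\<close> since \<open>L\<close> may
    be 0. \<open>Z * \<tau>\<close> bounds the bilinear expansion of the coefficient difference: in
    \<open>Z\<close> the 1 stands for the mixed term, where \<open>\<tau> \<le> 1\<close> is used,
    \<open>B\<close> for the change of frequency and \<open>norm \<omega>\<close> for the change of
    medium.\<close>
  define \<eta> where "\<eta> = min 1 (r / (L + 1))"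
  define Z where "Z = C * (1 + B + norm \<omega>)"
  define \<tau> where "\<tau> = min 1 (\<eta> / Z)"
  have \<eta>: "0 < \<eta>" "\<eta> \<le> 1" using r L(1) by (auto simp: \<eta>_def)
  have "L * \<eta> \<le> L * (r / (L + 1))"
    using L(1) by (intro mult_left_mono) (auto simp: \<eta>_def)
  also have "\<dots> < r" using L(1) r by (simp add: pos_divide_less_eq algebra_simps)
  finally have L\<eta>: "L * \<eta> < r" .
  have Z: "Z > 0" using C(1) B(1) by (simp add: Z_def add_pos_nonneg)
  have \<tau>: "0 < \<tau>" "\<tau> \<le> 1" using \<eta> Z by (auto simp: \<tau>_def)
  have \<tau>Z: "Z * \<tau> \<le> \<eta>"
  proof -
    have "Z * \<tau> \<le> Z * (\<eta> / Z)" using Z by (intro mult_left_mono) (auto simp: \<tau>_def)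
    then show ?thesis using Z by simp
  qed
  have ev_e: "\<forall>\<^sub>F s in F. esssup lborel (\<lambda>z. ereal (norm (e s z - eps z))) < ereal (\<tau>/2)"
    by (rule order_tendstoD(2)[OF e]) (use \<tau> in simp)
  have ev_m: "\<forall>\<^sub>F s in F. esssup lborel (\<lambda>z. ereal (norm (m s z - mu z))) < ereal (\<tau>/2)"
    by (rule order_tendstoD(2)[OF m]) (use \<tau> in simp)
  have ev_w: "\<forall>\<^sub>F s in F. dist (w s) \<omega> < \<tau>" using w \<tau>(1) by (rule tendstoD)
  show "\<forall>\<^sub>F s in F. dist (monodromy (e s) (m s) (w s)) (monodromy eps mu \<omega>) < r"
    using adm ev_e ev_m ev_w
  proof eventually_elim
    case (elim s)
    then have adms: "admissible (e s)" "admissible (m s)" by auto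
    obtain S where S: "locally_finite_set S" "\<And>z. z \<notin> S \<Longrightarrow> norm (e s z - eps z) \<le> \<tau>/2"
      using esssup_bound_off_jumps[OF adms(1) adm0(1) elim(2)] by blast
    obtain T where T: "locally_finite_set T" "\<And>z. z \<notin> T \<Longrightarrow> norm (m s z - mu z) \<le> \<tau>/2"
      using esssup_bound_off_jumps[OF adms(2) adm0(2) elim(3)] by blast
    have dw: "norm (w s - \<omega>) \<le> \<tau>" using elim(4) by (simp add: dist_norm)
    have "norm (monodromy (e s) (m s) (w s) - monodromy eps mu \<omega>) \<le> L * \<eta>"
    proof (rule L(2)[OF adms])
      show "locally_finite_set (S \<union> T)" using S(1) T(1) by (rule locally_finite_set_Un)
      fix z assume "z \<notin> S \<union> T"
      let ?p = "(e s z, m s z)" and ?q = "(eps z, mu z)"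
      have dp: "norm (?p - ?q) \<le> \<tau>"
      proof -
        have "norm (?p - ?q) \<le> norm (e s z - eps z) + norm (m s z - mu z)"
          by (simp add: norm_Pair_le)
        also have "\<dots> \<le> \<tau>/2 + \<tau>/2" using S(2) T(2) \<open>z \<notin> S \<union> T\<close> by (intro add_mono) auto
        finally show ?thesis by simp
      qed
      have "coef (e s) (m s) (w s) z - coef eps mu \<omega> z =
          medium_field (w s - \<omega>) (?p - ?q) + medium_field (w s - \<omega>) ?q + medium_field \<omega> (?p - ?q)"
        unfolding coef_eq_medium_field by (simp only: f.diff_left f.diff_right) simp
      also have "norm \<dots> \<le> norm (w s - \<omega>) * norm (?p - ?q) * C + norm (w s - \<omega>) * norm ?q * C
          + norm \<omega> * norm (?p - ?q) * C"
        by (intro norm_triangle_le add_mono C(2))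
      also have "\<dots> \<le> \<tau> * 1 * C + \<tau> * B * C + norm \<omega> * \<tau> * C"
        using C(1) \<tau> dw dp order_trans[OF dp \<tau>(2)] B(2)[of z]
        by (intro add_mono mult_right_mono mult_mono) auto
      also have "\<dots> = Z * \<tau>" by (simp add: Z_def algebra_simps)
      also have "\<dots> \<le> \<eta>" by (rule \<tau>Z)
      finally show "norm (coef (e s) (m s) (w s) z - coef eps mu \<omega> z) \<le> \<eta>" .
    qed (use \<eta> in auto)
    then show ?case using L\<eta> by (simp add: dist_norm)
  qed
qed

lemma monodromy_continuous_on_frequency:
  assumes "admissible eps" "admissible mu"
  shows "continuous_on A (monodromy eps mu)"
  unfolding continuous_on_def
proof
  fix \<omega> assume "\<omega> \<in> A"
  have "esssup lborel (\<lambda>z::real. ereal (norm (f z - f z))) = 0" for f :: medium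
    using esssup_const[of lborel "0::ereal"] by (simp add: zero_ereal_def)
  then show "(monodromy eps mu \<longlongrightarrow> monodromy eps mu \<omega>) (at \<omega> within A)"
    by (intro monodromy_tendsto assms) (auto simp: assms intro!: tendsto_ident_at)
qed

lemma monodromy_continuous_on_deformation:
  assumes "continuous_deformation h_eps h_mu" "continuous_on {0..1} g"
  shows "continuous_on {0..1} (\<lambda>t. monodromy (h_eps t) (h_mu t) (g t))"
  unfolding continuous_on_def
proof
  fix t :: real assume t: "t \<in> {0..1}"
  have adm: "admissible (h_eps s)" "admissible (h_mu s)" if "s \<in> {0..1}" for s
    using assms(1) that by (auto simp: continuous_deformation_def)
  show "((\<lambda>t. monodromy (h_eps t) (h_mu t) (g t)) \<longlongrightarrow> monodromy (h_eps t) (h_mu t) (g t))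
      (at t within {0..1})"
  proof (rule monodromy_tendsto)
    show "\<forall>\<^sub>F s in at t within {0..1}. admissible (h_eps s) \<and> admissible (h_mu s)"
      using adm unfolding eventually_at_filter by (auto intro: always_eventually)
    show "(g \<longlongrightarrow> g t) (at t within {0..1})" using assms(2) t unfolding continuous_on_def by blast
  qed (use t adm assms(1) in \<open>auto simp: continuous_deformation_def Linf_continuous_def\<close>)
qed

section \<open>Floquet multipliers\<close>

text \<open>An eigenvector \<open>v\<close> for a multiplier \<open>a\<close> on the unit circle
  extends to the Bloch wave \<open>T z *v v\<close>, which would make \<omega> an eigenfrequency at
  \<open>Arg a\<close>.\<close>

lemma hyperbolic_monodromy:
  assumes adm: "admissible eps" "admissible mu" and \<omega>: "\<omega> \<notin> dispersion_union eps mu"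
  shows "hyperbolic (monodromy eps mu \<omega>)"
  unfolding hyperbolic_def
proof (intro ballI notI)
  fix a assume a: "a \<in># eigenvalue_mset (monodromy eps mu \<omega>)" and "cmod a = 1"
  obtain v where v: "v \<noteq> 0" "monodromy eps mu \<omega> *v v = a *s v"
    using a by (rule eigenvector_exists)
  interpret mv: bounded_bilinear "(*v) :: cmat4 \<Rightarrow> cvec4 \<Rightarrow> cvec4"
    by (rule bounded_bilinear_matrix_vector_mult_complex)
  let ?c = "coef eps mu \<omega>"
  define T where "T z = transfer_matrix eps mu \<omega> z 0" for z
  define \<Phi> where "\<Phi> z = T z *v v" for z
  obtain S where S: "locally_finite_set S" "continuous_on UNIV T"
      "\<And>z. z \<notin> S \<Longrightarrow> (T has_vector_derivative ?c z ** T z) (at z)"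
    using transfer_matrix_solves[OF adm, of \<omega>] unfolding solves_ode_def T_def by blast
  have T0: "T 0 = mat 1" and T1: "T 1 = monodromy eps mu \<omega>"
    by (simp_all add: T_def monodromy_def transfer_matrix_0[OF adm])
  have cont: "continuous_on UNIV \<Phi>"
    unfolding \<Phi>_def by (intro mv.continuous_on S continuous_on_const)
  have der: "(\<Phi> has_vector_derivative ?c z *v \<Phi> z) (at z)" if "z \<notin> S" for z
    using bounded_linear.has_vector_derivative[OF mv.bounded_linear_left S(3)[OF that], of v]
    by (simp add: \<Phi>_def[abs_def] matrix_vector_mul_assoc)
  have sol: "solves_ode \<Phi> (\<lambda>z u. ?c z *v u)"
    unfolding solves_ode_def using cont S(1) der by blast
  have "linear ((*s) a :: cvec4 \<Rightarrow> cvec4)"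
    by (rule linearI) (simp_all add: vec_eq_iff algebra_simps)
  then interpret s: bounded_linear "(*s) a :: cvec4 \<Rightarrow> cvec4"
    by (simp add: linear_conv_bounded_linear)
  have sol_a: "solves_ode (\<lambda>z. a *s \<Phi> z) (\<lambda>z u. ?c z *v u)"
    unfolding solves_ode_def
  proof (intro conjI exI[of _ S] allI impI)
    show "continuous_on UNIV (\<lambda>z. a *s \<Phi> z)" by (rule s.continuous_on[OF cont])
    show "((\<lambda>z. a *s \<Phi> z) has_vector_derivative ?c z *v (a *s \<Phi> z)) (at z)" if "z \<notin> S" for z
      using s.has_vector_derivative[OF der[OF that]] by (simp add: vector_scalar_commute)
  qed (rule S)
  have periodic: "?c (z + 1) = ?c z" for z
    using adm by (simp add: coef_eq_medium_field admissible_def)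
  \<comment> \<open>Periodicity of the coefficients keeps the translate a solution, with the jumps
    moved by -1. It agrees with \<open>a *s \<Phi> z\<close> at \<open>z = 0\<close>, so uniqueness
    yields quasiperiodicity.\<close>
  have sol_shift: "solves_ode (\<lambda>z. \<Phi> (z + 1)) (\<lambda>z u. ?c z *v u)"
    unfolding solves_ode_def
  proof (intro conjI exI[of _ "(\<lambda>x. x + (-1)) ` S"] allI impI)
    show "continuous_on UNIV (\<lambda>z. \<Phi> (z + 1))"
      by (intro continuous_on_compose2[OF cont] continuous_intros) auto
    show "locally_finite_set ((\<lambda>x. x + (-1)) ` S)" by (rule locally_finite_set_shift[OF S(1)])
    fix z assume "z \<notin> (\<lambda>x. x + (-1)) ` S"
    then have "z + 1 \<notin> S" by (metis add_uminus_conv_diff add_diff_cancel_right' imageI)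
    have "(\<Phi> \<circ> (\<lambda>z. z + 1) has_vector_derivative 1 *\<^sub>R (?c (z + 1) *v \<Phi> (z + 1))) (at z)"
      by (rule vector_diff_chain_at)
         (use der[OF \<open>z + 1 \<notin> S\<close>] in \<open>auto intro!: derivative_eq_intros\<close>)
    then show "((\<lambda>z. \<Phi> (z + 1)) has_vector_derivative ?c z *v \<Phi> (z + 1)) (at z)"
      by (simp add: o_def periodic)
  qed
  obtain B where B: "\<And>z. norm (?c z) \<le> B" using coef_bounded[OF adm, of \<omega>] by blast
  have qp: "\<Phi> (z + 1) = a *s \<Phi> z" for z
    by (rule linear_solution_unique[OF bounded_bilinear_matrix_vector_mult_complex B sol_shift sol_a, of 0])
       (simp add: \<Phi>_def T0 T1 v)
  have "a \<noteq> 0" using \<open>cmod a = 1\<close> by auto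
  then have "a = exp (\<i> * of_real (Arg a))" using Arg_eq[of a] \<open>cmod a = 1\<close> by simp
  then have "quasiperiodic (Arg a) \<Phi>" using qp by (simp add: quasiperiodic_def)
  moreover have "\<Phi> 0 \<noteq> 0" using v by (simp add: \<Phi>_def T0)
  ultimately have "eigenfrequency eps mu (Arg a) \<omega>" using sol unfolding eigenfrequency_def by blast
  moreover have "Arg a \<in> {-pi..pi}" using Arg_bounded[of a] by auto
  ultimately show False using \<omega> unfolding dispersion_union_def by blast
qed

section \<open>Hermitian media\<close>

lemma conj_transpose_bounded_linear:
  "bounded_linear (conj_transpose :: complex^'n^'m \<Rightarrow> complex^'m^'n)"
  unfolding linear_conv_bounded_linear[symmetric]
  by (rule linearI) (simp_all add: conj_transpose_def vec_eq_iff)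

text \<open>The coefficients lie in the Lie algebra of the group preserving \<open>K\<close>. Hence
  \<open>conj_transpose (T z) ** K ** T z\<close> has derivative 0 off the jumps, and continuity
  carries its initial value \<open>K\<close> to \<open>z = 1\<close>.\<close>

lemma monodromy_preserves_form:
  assumes adm: "admissible eps" "admissible mu"
    and form: "\<And>z. conj_transpose (coef eps mu \<omega> z) ** K + K ** coef eps mu \<omega> z = 0"
  shows "conj_transpose (monodromy eps mu \<omega>) ** K ** monodromy eps mu \<omega> = K"
proof -
  let ?c = "coef eps mu \<omega>"
  define T where "T z = transfer_matrix eps mu \<omega> z 0" for z
  obtain S where S: "locally_finite_set S" "continuous_on UNIV T"
      "\<And>z. z \<notin> S \<Longrightarrow> (T has_vector_derivative ?c z ** T z) (at z)"
    using transfer_matrix_solves[OF adm, of \<omega>] unfolding solves_ode_def T_def by blast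
  interpret mm: bounded_bilinear "(**) :: cmat4 \<Rightarrow> cmat4 \<Rightarrow> cmat4"
    by (rule bounded_bilinear_matrix_mult_complex)
  interpret ct: bounded_linear "conj_transpose :: cmat4 \<Rightarrow> cmat4"
    by (rule conj_transpose_bounded_linear)
  define f where "f z = conj_transpose (T z) ** K ** T z" for z
  have "norm (f 1 - f 0) \<le> (\<lambda>_. 0) (1::real) - (\<lambda>_. 0) (0::real)"
  proof (rule norm_increment_le_off_finite[where f' = "\<lambda>_. 0" and \<phi>' = "\<lambda>_. 0"])
    show "finite (S \<inter> {0..1})" using S(1) by (simp add: locally_finite_set_def)
    show "continuous_on {0..1} f"
      unfolding f_def
      by (intro mm.continuous_on ct.continuous_on continuous_on_const continuous_on_subset[OF S(2)]) auto
    fix z :: real assume "z \<in> {0<..<1} - S \<inter> {0..1}"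
    then have "z \<notin> S" by auto
    note d = S(3)[OF this]
    have "(f has_vector_derivative conj_transpose (T z) ** K ** (?c z ** T z) +
        (conj_transpose (T z) ** 0 + conj_transpose (?c z ** T z) ** K) ** T z) (at z)"
      unfolding f_def
      by (intro mm.has_vector_derivative ct.has_vector_derivative d has_vector_derivative_const)
    also have "conj_transpose (T z) ** K ** (?c z ** T z) +
        (conj_transpose (T z) ** 0 + conj_transpose (?c z ** T z) ** K) ** T z
      = conj_transpose (T z) ** (conj_transpose (?c z) ** K + K ** ?c z) ** T z"
      by (simp add: conj_transpose_mult mm.add_left mm.add_right matrix_mul_assoc add.commute mm.zero_right)
    also have "\<dots> = 0" by (simp add: form mm.zero_left mm.zero_right)
    finally show "(f has_vector_derivative 0) (at z)" .
  qed (auto intro!: derivative_eq_intros)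
  then have "f 1 = f 0" by simp
  moreover have "conj_transpose (mat 1) = (mat 1 :: cmat4)"
    by (simp add: conj_transpose_def mat_def vec_eq_iff)
  ultimately show ?thesis
    by (simp add: f_def T_def monodromy_def transfer_matrix_0[OF adm])
qed

text \<open>The energy flux form and its variant obtained by reflecting the magnetic field.\<close>

definition flux_form :: cmat4 where "flux_form = block_mat 0 Q2 (- Q2) 0"
definition reflected_flux_form :: cmat4 where "reflected_flux_form = block_mat 0 Q2 Q2 0"

lemma det_flux_form: "det flux_form \<noteq> 0"
proof -
  have "flux_form ** flux_form = mat 1"
    by (simp add: flux_form_def block_mat_mult matrix_mult_minus Q2_square mat_uminus block_mat_scalar)
  then have "det flux_form * det flux_form = 1" by (metis det_mul det_I)
  then show ?thesis by auto
qed

lemma det_reflected_flux_form: "det reflected_flux_form \<noteq> 0"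
proof -
  have "reflected_flux_form ** reflected_flux_form = mat (-1)"
    by (simp add: reflected_flux_form_def block_mat_mult Q2_square block_mat_scalar)
  then have "det reflected_flux_form * det reflected_flux_form = (-1) ^ CARD(2 + 2)"
    by (metis det_mul det_mat)
  then show ?thesis by auto
qed

lemma conj_transpose_minus: "conj_transpose (- A) = - conj_transpose A"
  by (simp add: conj_transpose_def vec_eq_iff)

lemma conj_transpose_0 [simp]: "conj_transpose 0 = 0"
  by (simp add: conj_transpose_def vec_eq_iff)

lemma conj_transpose_flux_form: "conj_transpose flux_form = flux_form"
  by (simp add: flux_form_def conj_transpose_block_mat conj_transpose_minus conj_transpose_Q2)

lemma conj_transpose_reflected_flux_form: "conj_transpose reflected_flux_form = - reflected_flux_form"
  by (simp add: reflected_flux_form_def conj_transpose_block_mat conj_transpose_Q2 block_mat_uminus)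

lemma mat_mult_block_mat:
  "mat c ** block_mat A B C D = block_mat (mat c ** A) (mat c ** B) (mat c ** C) (mat c ** D)"
  by (simp add: vec_eq_iff split_sum_all mat_mult_nth)

lemmas cmat2_simps = vec_eq_iff forall_2 matrix_matrix_mult_def sum_2 mat_def Q2_def algebra_simps

lemma coef_block:
  "coef eps mu \<omega> z = block_mat 0 (mat (- \<i> * \<omega>) ** (Q2 ** mu z)) (mat (\<i> * \<omega>) ** (Q2 ** eps z)) 0"
proof -
  have "coef eps mu \<omega> z =
      block_mat 0 (mat \<omega> ** (- Q2) ** (mat \<i> ** mu z)) (mat \<omega> ** (- Q2) ** (mat \<i> ** (- eps z))) 0"
    unfolding coef_def A_mat_def matrix_inv_Q4
    by (simp add: Q4_def block_mat_uminus mat_mult_block_mat block_mat_mult)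
  also have "mat \<omega> ** (- Q2) ** (mat \<i> ** mu z) = mat (- \<i> * \<omega>) ** (Q2 ** mu z)"
    by (simp add: cmat2_simps)
  also have "mat \<omega> ** (- Q2) ** (mat \<i> ** (- eps z)) = mat (\<i> * \<omega>) ** (Q2 ** eps z)"
    by (simp add: cmat2_simps)
  finally show ?thesis .
qed

lemma Q2_mat_Q2: "Q2 ** (mat c ** (Q2 ** A)) = mat (- c) ** A"
  by (simp add: cmat2_simps)

text \<open>The two factors \<open>Q2\<close> cancel up to sign and leave a block diagonal matrix,
  on which the Hermitian symmetry of the medium acts blockwise.\<close>

lemma flux_form_coef:
  "flux_form ** coef eps mu \<omega> z = block_mat (mat (- \<i> * \<omega>) ** eps z) 0 0 (mat (- \<i> * \<omega>) ** mu z)"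
  by (simp add: flux_form_def coef_block block_mat_mult matrix_mult_minus Q2_mat_Q2 mat_uminus)

lemma reflected_flux_form_coef:
  "reflected_flux_form ** coef eps mu \<omega> z = block_mat (mat (- \<i> * \<omega>) ** eps z) 0 0 (mat (\<i> * \<omega>) ** mu z)"
  by (simp add: reflected_flux_form_def coef_block block_mat_mult Q2_mat_Q2)

lemma conj_transpose_mat_mult:
  fixes A :: "complex^'n^'n"
  assumes "conj_transpose A = A"
  shows "conj_transpose (mat c ** A) = mat (cnj c) ** A"
  using assms by (simp add: vec_eq_iff mat_mult_nth) (simp add: conj_transpose_def mat_mult_nth)

lemma mat_add: "mat a + mat b = (mat (a + b) :: 'a::semiring_1^'n^'n)"
  by (simp add: vec_eq_iff mat_def)

lemma hermitian_crystalD: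
  assumes "hermitian_crystal eps mu"
  shows "admissible eps" "admissible mu" "conj_transpose (eps z) = eps z" "conj_transpose (mu z) = mu z"
  using assms by (auto simp: hermitian_crystal_def photonic_crystal_def hermitian_posdef_def)

text \<open>Poynting's identity. Since \<open>flux_form\<close> is Hermitian, the two summands are
  adjoint to each other, and the factor \<open>- \<i> * \<omega>\<close> contributes twice its real
  part \<open>Im \<omega>\<close>.\<close>

lemma flux_form_derivative:
  assumes "hermitian_crystal eps mu"
  shows "conj_transpose (coef eps mu \<omega> z) ** flux_form + flux_form ** coef eps mu \<omega> z =
    mat (of_real (2 * Im \<omega>)) ** block_mat (eps z) 0 0 (mu z)"
proof -
  let ?c = "coef eps mu \<omega> z"
  have "conj_transpose ?c ** flux_form = conj_transpose (flux_form ** ?c)"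
    by (simp add: conj_transpose_mult conj_transpose_flux_form)
  then have "conj_transpose ?c ** flux_form + flux_form ** ?c =
      block_mat ((mat (cnj (- \<i> * \<omega>)) + mat (- \<i> * \<omega>)) ** eps z) 0 0
        ((mat (cnj (- \<i> * \<omega>)) + mat (- \<i> * \<omega>)) ** mu z)"
    by (simp only: flux_form_coef conj_transpose_block_mat conj_transpose_mat_mult
        hermitian_crystalD[OF assms] block_mat_add conj_transpose_0
        bounded_bilinear.add_left[OF bounded_bilinear_matrix_mult_complex] add_0_right)
  also have "mat (cnj (- \<i> * \<omega>)) + mat (- \<i> * \<omega>) = (mat (of_real (2 * Im \<omega>)) :: cmat2)"
    unfolding mat_add by (rule arg_cong[where f = mat]) (simp add: complex_eq_iff)
  finally show ?thesis by (simp add: mat_mult_block_mat)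
qed

text \<open>This form is skew-Hermitian, so the sum is a matrix minus its own adjoint. For imaginary
  \<omega> the scalars \<open>- \<i> * \<omega>\<close> and \<open>\<i> * \<omega>\<close> of the
  blocks are real, the matrix is Hermitian, and the difference vanishes.\<close>

lemma reflected_flux_form_derivative:
  assumes "hermitian_crystal eps mu" "Re \<omega> = 0"
  shows "conj_transpose (coef eps mu \<omega> z) ** reflected_flux_form + reflected_flux_form ** coef eps mu \<omega> z = 0"
proof -
  let ?c = "coef eps mu \<omega> z"
  have "conj_transpose ?c ** reflected_flux_form = - conj_transpose (reflected_flux_form ** ?c)"
    by (simp add: conj_transpose_mult conj_transpose_reflected_flux_form matrix_mult_minus)
  moreover have "cnj (- \<i> * \<omega>) = - \<i> * \<omega>" "cnj (\<i> * \<omega>) = \<i> * \<omega>"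
    using assms(2) by (simp_all add: complex_eq_iff)
  then have "conj_transpose (reflected_flux_form ** ?c) = reflected_flux_form ** ?c"
    by (simp only: reflected_flux_form_coef conj_transpose_block_mat conj_transpose_mat_mult
        hermitian_crystalD[OF assms(1)] conj_transpose_0)
  ultimately show ?thesis by simp
qed

section \<open>Reality of the Hermitian spectrum\<close>

lemma inner_complex_cnj: "x \<bullet> y = Re (cnj x * y)"
  by (simp add: inner_complex_def)

text \<open>The real inner product on complex vectors is the real part of the Hermitian one, with
  the same adjoints. Using it keeps the flux a real function, to which monotonicity applies.\<close>

lemma inner_conj_transpose: "(A *v u) \<bullet> w = u \<bullet> (conj_transpose A *v w)"
  for A :: "complex^'n^'m"
proof -
  have "(A *v u) \<bullet> w = (\<Sum>i\<in>UNIV. \<Sum>j\<in>UNIV. Re (cnj (A $ i $ j) * cnj (u $ j) * w $ i))"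
    by (simp only: inner_vec_def matrix_vector_mult_def vec_lambda_beta inner_complex_cnj
        cnj_sum Re_sum sum_distrib_right complex_cnj_mult)
  also have "\<dots> = (\<Sum>j\<in>UNIV. \<Sum>i\<in>UNIV. Re (cnj (A $ i $ j) * cnj (u $ j) * w $ i))"
    by (rule sum.swap)
  also have "\<dots> = u \<bullet> (conj_transpose A *v w)"
    by (simp only: inner_vec_def matrix_vector_mult_def vec_lambda_beta inner_complex_cnj
        Re_sum sum_distrib_left conj_transpose_def mult_ac)
  finally show ?thesis .
qed

lemma hermitian_posdef_inner:
  assumes "hermitian_posdef M" "v \<noteq> 0"
  shows "0 < v \<bullet> (M *v v)"
proof -
  have "Re (\<Sum>i\<in>UNIV. cnj (v $ i) * (M *v v) $ i) = v \<bullet> (M *v v)"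
    by (simp add: inner_vec_def inner_complex_def)
  then show ?thesis using assms unfolding hermitian_posdef_def by metis
qed

lemma energy_density_pos:
  assumes "hermitian_posdef A" "hermitian_posdef B" "v \<noteq> 0"
  shows "0 < v \<bullet> (block_mat A 0 0 B *v v)"
proof -
  define E :: "complex^2" where "E = (\<chi> i. v $ Inl i)"
  define H :: "complex^2" where "H = (\<chi> i. v $ Inr i)"
  have eq: "v \<bullet> (block_mat A 0 0 B *v v) = E \<bullet> (A *v E) + H \<bullet> (B *v H)"
    by (simp add: inner_vec_def matrix_vector_mult_def sum_UNIV_sum_type E_def H_def)
  have "E \<noteq> 0 \<or> H \<noteq> 0"
    using assms(3) by (simp add: vec_eq_iff split_sum_all E_def H_def)
  moreover have "0 \<le> E \<bullet> (A *v E)" "0 \<le> H \<bullet> (B *v H)"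
    using hermitian_posdef_inner[OF assms(1), of E] hermitian_posdef_inner[OF assms(2), of H]
    by (cases "E = 0"; cases "H = 0"; simp)+
  ultimately show ?thesis
    using hermitian_posdef_inner[OF assms(1), of E] hermitian_posdef_inner[OF assms(2), of H]
    unfolding eq by (auto intro: add_pos_nonneg add_nonneg_pos)
qed

lemma inner_scalar_mult: "cmod c = 1 \<Longrightarrow> (c *s u) \<bullet> (c *s w) = u \<bullet> w" for u w :: "complex^'n"
proof -
  assume c: "cmod c = 1"
  then have "(c * a) \<bullet> (c * b) = a \<bullet> b" for a b :: complex
  proof -
    have "(c * a) \<bullet> (c * b) = Re (cnj c * c * (cnj a * b))"
      by (simp add: inner_complex_def algebra_simps)
    also have "cnj c * c = 1" using c complex_norm_square[of c] by (simp add: mult.commute)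
    finally show ?thesis by (simp add: inner_complex_def)
  qed
  then show ?thesis by (simp add: inner_vec_def)
qed

text \<open>The energy flux is strictly monotone along a nonzero solution at a nonreal frequency,
  yet periodic along a Bloch wave.\<close>

lemma hermitian_dispersion_real:
  assumes H: "hermitian_crystal eps mu" and \<omega>: "\<omega> \<in> dispersion_union eps mu"
  shows "Im \<omega> = 0"
proof (rule ccontr)
  assume im: "Im \<omega> \<noteq> 0"
  obtain k \<Phi> z0 where sol: "solves_ode \<Phi> (\<lambda>z v. coef eps mu \<omega> z *v v)"
      and qp: "quasiperiodic k \<Phi>" and z0: "\<Phi> z0 \<noteq> (0 :: cvec4)"
    using \<omega> unfolding dispersion_union_def eigenfrequency_def by blast
  let ?c = "coef eps mu \<omega>" and ?K = "flux_form"
  obtain S where S: "locally_finite_set S" "continuous_on UNIV \<Phi>"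
      "\<And>z. z \<notin> S \<Longrightarrow> (\<Phi> has_vector_derivative ?c z *v \<Phi> z) (at z)"
    using sol unfolding solves_ode_def by blast
  interpret mv: bounded_bilinear "(*v) :: cmat4 \<Rightarrow> cvec4 \<Rightarrow> cvec4"
    by (rule bounded_bilinear_matrix_vector_mult_complex)
  \<comment> \<open>The sign makes the flux nonincreasing in either half-plane.\<close>
  define f where "f z = - sgn (Im \<omega>) * (\<Phi> z \<bullet> (?K *v \<Phi> z))" for z
  define e where "e z = \<Phi> z \<bullet> (block_mat (eps z) 0 0 (mu z) *v \<Phi> z)" for z
  have e0: "0 < e z" if "\<Phi> z \<noteq> 0" for z
    unfolding e_def using H that by (intro energy_density_pos) (auto simp: hermitian_crystal_def)
  have cont: "continuous_on A f" for A
    unfolding f_def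
    by (intro continuous_intros mv.continuous_on continuous_on_subset[OF S(2)]) auto
  have der: "(f has_vector_derivative - (2 * \<bar>Im \<omega>\<bar> * e z)) (at z)" if "z \<notin> S" for z
  proof -
    note d = S(3)[OF that]
    have "((\<lambda>z. \<Phi> z \<bullet> (?K *v \<Phi> z)) has_vector_derivative
        \<Phi> z \<bullet> (?K *v (?c z *v \<Phi> z)) + (?c z *v \<Phi> z) \<bullet> (?K *v \<Phi> z)) (at z)"
      by (intro bounded_bilinear.has_vector_derivative[OF bounded_bilinear_inner] d
          bounded_linear.has_vector_derivative[OF mv.bounded_linear_right])
    also have "\<Phi> z \<bullet> (?K *v (?c z *v \<Phi> z)) + (?c z *v \<Phi> z) \<bullet> (?K *v \<Phi> z)
        = \<Phi> z \<bullet> ((conj_transpose (?c z) ** ?K + ?K ** ?c z) *v \<Phi> z)"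
      by (simp add: inner_conj_transpose matrix_vector_mul_assoc mv.add_left inner_add_right add.commute)
    also have "\<dots> = 2 * Im \<omega> * e z"
    proof -
      have "mat (of_real r) *v u = r *\<^sub>R u" for r and u :: cvec4
        unfolding mat_mult_vec by (simp add: vec_eq_iff complex_eq_iff)
      then show ?thesis
        unfolding flux_form_derivative[OF H] e_def by (simp only: matrix_vector_mul_assoc[symmetric] inner_scaleR_right)
    qed
    finally have "((\<lambda>z. - sgn (Im \<omega>) * (\<Phi> z \<bullet> (?K *v \<Phi> z))) has_vector_derivative
        - sgn (Im \<omega>) * (2 * Im \<omega> * e z)) (at z)"
      by (rule has_vector_derivative_mult_right)
    then show ?thesis by (simp add: f_def[abs_def] abs_sgn mult_ac)
  qed
  have antimono: "f y \<le> f x" if "x \<le> y" for x y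
  proof (rule nonincreasing_off_finite[OF _ that cont])
    show "finite (S \<inter> {x..y})" using S(1) by (simp add: locally_finite_set_def)
    fix z assume "z \<in> {x<..<y} - S \<inter> {x..y}"
    then show "(f has_vector_derivative - (2 * \<bar>Im \<omega>\<bar> * e z)) (at z)" by (intro der) auto
    have "0 \<le> e z" using e0[of z] by (cases "\<Phi> z = 0") (auto simp: e_def)
    then show "- (2 * \<bar>Im \<omega>\<bar> * e z) \<le> 0" by simp
  qed
  have per: "f (z + 1) = f z" for z
  proof -
    have "\<Phi> (z + 1) = exp (\<i> * of_real k) *s \<Phi> z" using qp by (simp add: quasiperiodic_def)
    moreover have "cmod (exp (\<i> * of_real k)) = 1" by simp
    ultimately show ?thesis
      by (simp only: f_def vector_scalar_commute inner_scalar_mult)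
  qed
  \<comment> \<open>A monotone function with equal values at both ends of a period is constant in
    between.\<close>
  have const: "f z = f z0" if "z \<in> {z0<..<z0+1}" for z
    using antimono[of z0 z] antimono[of z "z0 + 1"] per[of z0] that by force
  have "open (\<Phi> -` (- {0}))"
    using S(2) by (intro continuous_open_vimage) (auto simp: continuous_on_eq_continuous_at)
  moreover have "z0 \<in> \<Phi> -` (- {0})" using z0 by simp
  ultimately obtain d where d: "d > 0" "ball z0 d \<subseteq> \<Phi> -` (- {0})"
    unfolding open_contains_ball by blast
  \<comment> \<open>There may be a jump at \<open>z0\<close> itself. By continuity
    \<open>\<Phi>\<close> stays nonzero nearby, \<open>min d 1\<close> keeps \<open>U\<close> inside
    one period, and some point of \<open>U\<close> is no jump; there the derivative is both 0 and
    strictly negative.\<close>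
  define U where "U = {z0<..<z0 + min d 1}"
  have "open U" "U \<noteq> {}" using d(1) by (auto simp: U_def)
  then obtain z where z: "z \<in> U" "z \<notin> S" using locally_finite_set_avoid[OF S(1)] by blast
  have "\<Phi> z \<noteq> 0" using d(2) z(1) by (auto simp: U_def dist_real_def subset_iff)
  have "(f has_vector_derivative 0) (at z)"
    by (rule has_vector_derivative_transform_within_open[OF has_vector_derivative_const[of "f z0"] \<open>open U\<close> z(1)])
       (use const in \<open>auto simp: U_def\<close>)
  then have "- (2 * \<bar>Im \<omega>\<bar> * e z) = 0"
    using der[OF z(2)] vector_derivative_unique_at by blast
  then show False using im e0[OF \<open>\<Phi> z \<noteq> 0\<close>] by simp
qed

lemma hermitian_spectral_index:
  assumes H: "hermitian_crystal eps mu" and \<omega>: "\<omega> \<notin> dispersion_union eps mu"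
  shows "spectral_index (monodromy eps mu \<omega>) = 0"
proof -
  note adm = hermitian_crystalD(1,2)[OF H]
  show ?thesis
  proof (cases "Im \<omega> = 0")
    case True
    show ?thesis
    proof (rule spectral_index_eq_0[OF monodromy_preserves_form[OF adm] det_flux_form])
      show "conj_transpose (coef eps mu \<omega> z) ** flux_form + flux_form ** coef eps mu \<omega> z = 0" for z
        using flux_form_derivative[OF H] True by simp
    qed
  next
    case False
    define \<omega>' where "\<omega>' = \<i> * of_real (Im \<omega>)"
    have im: "Im w = Im \<omega>" if "w \<in> closed_segment \<omega> \<omega>'" for w
    proof -
      from that obtain u where "w = (1 - u) *\<^sub>R \<omega> + u *\<^sub>R \<omega>'"
        unfolding in_segment by blast
      then have "Im w = (1 - u) * Im \<omega> + u * Im \<omega>" by (simp add: \<omega>'_def)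
      then show ?thesis by (simp add: algebra_simps)
    qed
    have "spectral_index (monodromy eps mu \<omega>) = spectral_index (monodromy eps mu \<omega>')"
    proof (rule spectral_index_constant_on_connected
        [where A = "closed_segment \<omega> \<omega>'" and M = "monodromy eps mu"])
      show "connected (closed_segment \<omega> \<omega>')" by simp
      show "continuous_on (closed_segment \<omega> \<omega>') (monodromy eps mu)"
        by (rule monodromy_continuous_on_frequency[OF adm])
      show "hyperbolic (monodromy eps mu w)" if "w \<in> closed_segment \<omega> \<omega>'" for w
        using im[OF that] False hermitian_dispersion_real[OF H, of w]
        by (intro hyperbolic_monodromy[OF adm]) auto
    qed auto
    also have "\<dots> = 0"
      by (rule spectral_index_eq_0[OF monodromy_preserves_form[OF adm] det_reflected_flux_form])
         (rule reflected_flux_form_derivative[OF H], simp add: \<omega>'_def)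
    finally show ?thesis .
  qed
qed

section \<open>Transport of the index along the deformation\<close>

theorem theorem11:
  fixes h_eps h_mu :: "real \<Rightarrow> real \<Rightarrow> complex^2^2"
    and eps_H mu_H eps mu :: "real \<Rightarrow> complex^2^2"
    and D :: "complex set"
    and g :: "real \<Rightarrow> complex"
  assumes "continuous_deformation h_eps h_mu"
    and "h_eps 0 = eps_H" and "h_mu 0 = mu_H"
    and "hermitian_crystal eps_H mu_H"
    and "h_eps 1 = eps" and "h_mu 1 = mu"
    and "D \<in> components (- dispersion_union eps mu)"
    and "has_band_gap eps_H mu_H"
    and "continuous_on {0..1} g"
    and "\<And>t. t \<in> {0..1} \<Longrightarrow> g t \<in> - dispersion_union (h_eps t) (h_mu t)"
    and "g 1 \<in> D"
  shows "principal_gapped_component eps mu D"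
proof -
  have adm: "admissible (h_eps t)" "admissible (h_mu t)" if "t \<in> {0..1}" for t
    using assms(1) that by (auto simp: continuous_deformation_def)
  have adm1: "admissible eps" "admissible mu" using adm[of 1] assms(5,6) by auto
  have "spectral_index (monodromy (h_eps 1) (h_mu 1) (g 1)) =
      spectral_index (monodromy (h_eps 0) (h_mu 0) (g 0))"
  proof (rule spectral_index_constant_on_connected
      [where A = "{0..1}" and M = "\<lambda>t. monodromy (h_eps t) (h_mu t) (g t)"])
    show "continuous_on {0..1} (\<lambda>t. monodromy (h_eps t) (h_mu t) (g t))"
      by (rule monodromy_continuous_on_deformation[OF assms(1,9)])
    show "hyperbolic (monodromy (h_eps t) (h_mu t) (g t))" if "t \<in> {0..1}" for t
      using assms(10)[OF that] by (intro hyperbolic_monodromy adm that) simp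
  qed auto
  also have "\<dots> = 0"
    using assms(2-4) assms(10)[of 0] by (intro hermitian_spectral_index) auto
  finally have idx1: "spectral_index (monodromy eps mu (g 1)) = 0" using assms(5,6) by simp
  \<comment> \<open>The curve fixes the index only at \<open>g 1\<close>; connectedness of
    \<open>D\<close> spreads it over the component.\<close>
  have "index_at eps mu \<omega> = 0" if "\<omega> \<in> D" for \<omega>
  proof -
    have "spectral_index (monodromy eps mu \<omega>) = spectral_index (monodromy eps mu (g 1))"
    proof (rule spectral_index_constant_on_connected[where A = D and M = "monodromy eps mu"])
      show "connected D" using assms(7) by (rule in_components_connected)
      show "continuous_on D (monodromy eps mu)" by (rule monodromy_continuous_on_frequency[OF adm1])
      show "hyperbolic (monodromy eps mu w)" if "w \<in> D" for w
        using in_components_subset[OF assms(7)] that by (intro hyperbolic_monodromy adm1) auto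
    qed (use that assms(11) in auto)
    then show ?thesis using idx1 by (simp add: index_at_def spectral_index_def)
  qed
  \<comment> \<open>\<open>Ind\<close> is a definite description: uniqueness of the common value
    needs a point of \<open>D\<close>, and \<open>g 1\<close> is one.\<close>
  then have "Ind eps mu D = 0"
    unfolding Ind_def using assms(11) by (intro the_equality) auto
  then show ?thesis using assms(7) by (simp add: principal_gapped_component_def)
qed

end
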